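(* Let $t_n(231)$ be the number of shallow $231$-avoiding permutations in $S_n$ (with $t_0(231)=1$), and $T_{231}(x)=\sum_{n\ge0}t_n(231)x^n$. Then $$T_{231}(x)=\frac{1-3x+2x^2-x^3-x^4-x^5}{1-4x+4x^2-2x^3-x^4-x^5}.$$ The same generating function counts shallow $312$-avoiding permutations.
   Context: For $\pi\in S_n$: $D(\pi)=\sum_{i}|\pi_i-i|$, $I(\pi)$ is the number of inversions, $T(\pi)=n-\mathrm{cyc}(\pi)$ with $\mathrm{cyc}$ the number of cycles in the disjoint cycle decomposition; $\pi$ is shallow if $I(\pi)+T(\pi)=D(\pi)$. A permutation avoids a pattern $\sigma$ if it has no subsequence order-isomorphic to $\sigma$. *)

theory Defs
  imports "HOL-Combinatorics.Permutations" "HOL-Computational_Algebra.Formal_Power_Series"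
begin

text \<open>Permutations of S_n are modelled as functions p :: nat => nat with
  p permutes {1..n}; positions and values range over 1..n.\<close>

definition displacement :: "nat \<Rightarrow> (nat \<Rightarrow> nat) \<Rightarrow> int" where
  "displacement n p = (\<Sum>i\<in>{1..n}. \<bar>int (p i) - int i\<bar>)"

definition inversions :: "nat \<Rightarrow> (nat \<Rightarrow> nat) \<Rightarrow> nat" where
  "inversions n p = card {(i, j). i \<in> {1..n} \<and> j \<in> {1..n} \<and> i < j \<and> p i > p j}"

definition cycle_of :: "nat \<Rightarrow> (nat \<Rightarrow> nat) \<Rightarrow> nat \<Rightarrow> nat set" where
  "cycle_of n p i = {j \<in> {1..n}. \<exists>k. (p ^^ k) i = j}"

definition num_cycles :: "nat \<Rightarrow> (nat \<Rightarrow> nat) \<Rightarrow> nat" where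
  "num_cycles n p = card (cycle_of n p ` {1..n})"

definition reflection_length :: "nat \<Rightarrow> (nat \<Rightarrow> nat) \<Rightarrow> int" where
  "reflection_length n p = int n - int (num_cycles n p)"

definition shallow :: "nat \<Rightarrow> (nat \<Rightarrow> nat) \<Rightarrow> bool" where
  "shallow n p \<longleftrightarrow> int (inversions n p) + reflection_length n p = displacement n p"

definition contains_pattern :: "nat \<Rightarrow> (nat \<Rightarrow> nat) \<Rightarrow> nat list \<Rightarrow> bool" where
  "contains_pattern n p \<sigma> \<longleftrightarrow> (\<exists>idx :: nat \<Rightarrow> nat.
      (\<forall>a<length \<sigma>. idx a \<in> {1..n}) \<and>
      (\<forall>a b. a < b \<and> b < length \<sigma> \<longrightarrow> idx a < idx b) \<and>
      (\<forall>a<length \<sigma>. \<forall>b<length \<sigma>. (p (idx a) < p (idx b) \<longleftrightarrow> \<sigma> ! a < \<sigma> ! b)))"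

definition avoids :: "nat \<Rightarrow> (nat \<Rightarrow> nat) \<Rightarrow> nat list \<Rightarrow> bool" where
  "avoids n p \<sigma> \<longleftrightarrow> \<not> contains_pattern n p \<sigma>"

definition shallow_avoiders :: "nat list \<Rightarrow> nat \<Rightarrow> nat" where
  "shallow_avoiders \<sigma> n = card {p. p permutes {1..n} \<and> shallow n p \<and> avoids n p \<sigma>}"

end

theory Submission
  imports Defs "HOL-Combinatorics.Orbits"
begin

text \<open>Removing the maximum of a permutation and putting the last entry in its place changes the
  nonnegative defect \<open>D - I - T\<close> by twice the smaller of two counts: the larger entries before
  the moved entry and the smaller entries after it. So a permutation is shallow iff every such
  removal turns the last entry into a left-to-right maximum or a right-to-left minimum.

  A 231-avoiding permutation is a direct sum whose last summand starts with its maximum, so it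
  suffices to count the shallow 231-avoiding permutations \<open>n us (n-1) vs\<close>. Here \<open>us\<close> lies
  below \<open>vs\<close>, and the two parts decouple: \<open>us\<close> is again what follows a leading maximum, and
  \<open>vs\<close> is what can follow the two largest entries when \<open>us\<close> is empty. Removing maxima
  and minima shows that such \<open>vs\<close> of length \<open>l \<ge> 1\<close> form three explicit families with
  \<open>l\<close>, \<open>l - 2\<close> and \<open>l - 3\<close> members, made of at most three decreasing blocks. The generating
  functions \<open>T\<close>, \<open>A\<close>, \<open>V\<close> of all permutations, those starting with the maximum, and
  the \<open>vs\<close> satisfy \<open>T = 1 + A T\<close> and \<open>A = X + X A V\<close>. Inversion of permutations exchanges
  231 and 312 and preserves \<open>D\<close>, \<open>I\<close> and \<open>T\<close>.\<close>

subsection \<open>Shallow lists\<close>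

text \<open>The rule \<open>step\<close> undoes the removal of the maximum \<open>M\<close>, which is replaced by the last entry
  \<open>e\<close>. Its last premise, that \<open>e\<close> becomes a left-to-right maximum or a right-to-left minimum,
  says exactly that the removal preserves the defect \<open>D - I - T\<close>.\<close>

inductive shallow_list :: "'a::linorder list \<Rightarrow> bool" where
  Nil: "shallow_list []"
| snoc: "shallow_list us \<Longrightarrow> \<forall>u\<in>set us. u < M \<Longrightarrow> shallow_list (us @ [M])"
| step: "shallow_list (us @ e # vs) \<Longrightarrow> \<forall>u\<in>set (us @ e # vs). u < M \<Longrightarrow>
    (\<forall>u\<in>set us. u < e) \<or> (\<forall>v\<in>set vs. e < v) \<Longrightarrow> shallow_list (us @ M # vs @ [e])"

lemma shallow_list_snoc_max:
  assumes "\<forall>u\<in>set us. u < M"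
  shows "shallow_list (us @ [M]) \<longleftrightarrow> shallow_list us"
proof
  assume "shallow_list (us @ [M])"
  then show "shallow_list us"
    by (cases rule: shallow_list.cases) (use assms in force)+
qed (use assms in \<open>auto intro: shallow_list.snoc\<close>)

text \<open>The position of the maximum decides which rule was applied last and with which
  parameters, so \<open>step\<close> can be inverted. Together with
  \<open>shallow_list_snoc_max\<close> this gives the equivalences by which later proofs remove a
  maximum or put it back.\<close>

lemma shallow_list_max:
  assumes "\<forall>u\<in>set (us @ e # vs). u < M"
  shows "shallow_list (us @ M # vs @ [e]) \<longleftrightarrow>
    shallow_list (us @ e # vs) \<and> ((\<forall>u\<in>set us. u < e) \<or> (\<forall>v\<in>set vs. e < v))"
proof
  assume "shallow_list (us @ M # vs @ [e])"
  then show "shallow_list (us @ e # vs) \<and> ((\<forall>u\<in>set us. u < e) \<or> (\<forall>v\<in>set vs. e < v))"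
  proof (cases rule: shallow_list.cases)
    case (snoc us' M')
    have "us @ M # vs = us'" "e = M'"
      using snoc(1) by (metis append.assoc append_Cons butlast_snoc, metis append.assoc append_Cons last_snoc)
    with snoc assms show ?thesis by force
  next
    case (step us' e' vs' M')
    have eq: "us @ M # vs = us' @ M' # vs'" and [simp]: "e' = e"
      using step(1) by (metis append.assoc append_Cons butlast_snoc, metis append.assoc append_Cons last_snoc)
    have "M \<in> set (us' @ M' # vs')" "M' \<in> set (us @ M # vs)"
      using eq by (metis in_set_conv_decomp)+
    then have "M = M'"
      using assms step(3) by (auto dest: less_asym)
    moreover have "M \<notin> set us" "M \<notin> set vs"
      using assms by auto
    ultimately have "us = us'" "vs = vs'"
      using eq by (simp_all add: append_Cons_eq_iff)
    with step show ?thesis by simp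
  qed simp
qed (use assms shallow_list.step[OF _ assms] in simp)

lemma shallow_list_Cons_max:
  assumes "\<forall>v\<in>set (vs @ [e]). v < M"
  shows "shallow_list (M # vs @ [e]) \<longleftrightarrow> shallow_list (e # vs)"
  using shallow_list_max[of "[]" e vs M] assms by auto

lemma shallow_list_single [simp]: "shallow_list [x]"
  using shallow_list.snoc[of "[]" x] shallow_list.Nil by simp

lemma shallow_list_distinct: "shallow_list xs \<Longrightarrow> distinct xs"
  by (induction rule: shallow_list.induct) auto

text \<open>The two cases match the rules \<open>snoc\<close> and \<open>step\<close>, so that an
  induction on a list can follow the removal of its maximum.\<close>

lemma split_list_Max:
  fixes xs :: "'a::linorder list"
  assumes "distinct xs" "xs \<noteq> []"
  obtains us M where "xs = us @ [M]" "\<forall>u\<in>set us. u < M"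
  | us M vs e where "xs = us @ M # vs @ [e]" "\<forall>u\<in>set (us @ e # vs). u < M"
proof -
  have "Max (set xs) \<in> set xs"
    using assms by simp
  then obtain us vs where xs: "xs = us @ Max (set xs) # vs"
    by (meson split_list)
  have lt: "u < Max (set xs)" if "u \<in> set (us @ vs)" for u
  proof -
    have "u \<in> set xs" using xs that by (metis Un_iff insertCI list.set(2) set_append)
    moreover have "u \<noteq> Max (set xs)"
      using xs that assms(1) by (metis distinct_append distinct.simps(2) Un_iff disjoint_iff insertCI list.set(2) set_append)
    ultimately show ?thesis
      by (simp add: order.not_eq_order_implies_strict)
  qed
  show ?thesis
  proof (cases vs rule: rev_cases)
    case Nil
    then show ?thesis using that(1)[of us "Max (set xs)"] xs lt by auto
  next
    case (snoc vs' e)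
    then show ?thesis using that(2)[of us "Max (set xs)" vs' e] xs lt by auto
  qed
qed

section \<open>Relabelling and splitting shallow lists\<close>

lemma shallow_list_map_imp:
  assumes "shallow_list xs" "strict_mono_on (set xs) f"
  shows "shallow_list (map f xs)"
  using assms
proof (induction rule: shallow_list.induct)
  case Nil
  then show ?case by (simp add: shallow_list.Nil)
next
  case (snoc us M)
  then show ?case
    by (auto intro!: shallow_list.snoc simp: strict_mono_on_def)
next
  case (step us e vs M)
  then have "shallow_list (map f us @ f e # map f vs)"
    by (auto simp: strict_mono_on_def)
  moreover have "\<forall>u\<in>set (map f us @ f e # map f vs). u < f M"
    "(\<forall>u\<in>set (map f us). u < f e) \<or> (\<forall>v\<in>set (map f vs). f e < v)"
    using step by (auto simp: strict_mono_on_def)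
  ultimately show ?case
    using shallow_list.step by fastforce
qed

text \<open>Only the relative order of the entries matters; the converse direction applies
  \<open>shallow_list_map_imp\<close> to the inverse of \<open>f\<close> on the entries.\<close>

lemma shallow_list_map:
  fixes f :: "'a::linorder \<Rightarrow> 'b::linorder"
  assumes "strict_mono_on (set xs) f"
  shows "shallow_list (map f xs) \<longleftrightarrow> shallow_list xs"
proof
  let ?g = "inv_into (set xs) f"
  have inj: "inj_on f (set xs)"
    using assms by (rule strict_mono_on_imp_inj_on)
  assume "shallow_list (map f xs)"
  moreover have "strict_mono_on (set (map f xs)) ?g"
  proof (rule strict_mono_onI)
    fix a b assume "a \<in> set (map f xs)" "b \<in> set (map f xs)" "a < b"
    then obtain x y where "x \<in> set xs" "y \<in> set xs" "a = f x" "b = f y" by auto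
    with \<open>a < b\<close> assms inj show "?g a < ?g b"
      by (simp add: strict_mono_on_less)
  qed
  ultimately have "shallow_list (map ?g (map f xs))"
    by (rule shallow_list_map_imp)
  also have "map ?g (map f xs) = xs"
    using inj by (simp add: map_idI)
  finally show "shallow_list xs" .
qed (rule shallow_list_map_imp[OF _ assms])

lemma shallow_list_Cons_max_cong:
  assumes "\<forall>u\<in>set us. u < x" "\<forall>u\<in>set us. u < y"
  shows "shallow_list (x # us) \<longleftrightarrow> shallow_list (y # us)"
proof -
  let ?f = "\<lambda>u. if u = x then y else u"
  have "strict_mono_on (set (x # us)) ?f"
    using assms by (auto simp: strict_mono_on_def)
  moreover have "map ?f (x # us) = y # us"
    using assms by (auto intro!: map_idI)
  ultimately show ?thesis
    using shallow_list_map by metis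
qed

text \<open>Removing the maximum takes place inside \<open>vs\<close>. The entries of
  \<open>us\<close> lie below the moved entry \<open>e\<close> and to its left, so they affect
  neither alternative of \<open>step\<close>.\<close>

lemma shallow_list_append:
  assumes "\<forall>u\<in>set us. \<forall>v\<in>set vs. u < v" "distinct vs"
  shows "shallow_list (us @ vs) \<longleftrightarrow> shallow_list us \<and> shallow_list vs"
  using assms
proof (induction vs rule: length_induct)
  case (1 vs)
  show ?case
  proof (cases "vs = []")
    case True
    then show ?thesis by (simp add: shallow_list.Nil)
  next
    case False
    from \<open>distinct vs\<close> False show ?thesis
    proof (cases rule: split_list_Max)
      case (1 xs M)
      then show ?thesis
        using 1 "1.IH"[rule_format, of xs] "1.prems"
          shallow_list_snoc_max[of "us @ xs" M] shallow_list_snoc_max[of xs M] by auto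
    next
      case (2 xs M ys e)
      then show ?thesis
        using "1.IH"[rule_format, of "xs @ e # ys"] "1.prems"
          shallow_list_max[of "us @ xs" e ys M] shallow_list_max[of xs e ys M] by auto
    qed
  qed
qed

text \<open>The entries smaller than everything else decouple from the rest, the first entry
  playing the role of the maximum for both parts.\<close>

lemma shallow_list_Cons_append:
  assumes "\<forall>u\<in>set us. u < x" "\<forall>u\<in>set us. \<forall>z\<in>set zs. u < z" "distinct (x # zs)"
  shows "shallow_list (x # us @ zs) \<longleftrightarrow> shallow_list (x # us) \<and> shallow_list (x # zs)"
  using assms
proof (induction "length zs" arbitrary: x zs rule: less_induct)
  case (less zs x)
  show ?case
  proof (cases "zs = []")
    case True
    then show ?thesis by simp
  next
    case False
    show ?thesis
    proof (cases "\<forall>z\<in>set zs. z < x")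
      case True
      \<comment> \<open>Removing \<open>x\<close> moves \<open>e\<close> to the front. Since
        \<open>e\<close> again exceeds all of \<open>us\<close>, the induction hypothesis applies
        with \<open>e\<close> in the role of \<open>x\<close>.\<close>
      obtain zs' e where zs: "zs = zs' @ [e]"
        using False by (meson rev_exhaust)
      have "shallow_list (x # us @ zs) \<longleftrightarrow> shallow_list (e # us @ zs')"
        using shallow_list_Cons_max[of "us @ zs'" e x] True less.prems zs by auto
      also have "\<dots> \<longleftrightarrow> shallow_list (e # us) \<and> shallow_list (e # zs')"
        using less.hyps[of zs' e] less.prems zs by auto
      also have "shallow_list (e # us) \<longleftrightarrow> shallow_list (x # us)"
        using less.prems zs by (intro shallow_list_Cons_max_cong) auto
      also have "shallow_list (e # zs') \<longleftrightarrow> shallow_list (x # zs)"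
        using shallow_list_Cons_max[of zs' e x] True zs by auto
      finally show ?thesis .
    next
      case notmax: False
      from less.prems(3) have "distinct zs" by simp
      obtain z where z: "z \<in> set zs" "x \<le> z"
        using notmax by (auto simp: not_less)
      from \<open>distinct zs\<close> False show ?thesis
      proof (cases rule: split_list_Max)
        case (1 xs M)
        then have "x < M"
          using z less.prems(3) by (auto intro: le_less_trans)
        then show ?thesis
          using 1 less.hyps[of xs x] less.prems
            shallow_list_snoc_max[of "x # us @ xs" M] shallow_list_snoc_max[of "x # xs" M] by auto
      next
        case (2 xs M ys e)
        then have "x < M"
          using z less.prems(3) by (auto intro: le_less_trans)
        \<comment> \<open>Here the maximum and the moved entry \<open>e\<close> both belong to
          \<open>zs\<close>. As \<open>us\<close> lies below \<open>e\<close>, the last premise of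
          \<open>step\<close> is the same with and without \<open>us\<close>.\<close>
        have lt: "\<forall>u\<in>set us. u < M \<and> u < e"
          using less.prems(2) 2 by auto
        have "shallow_list (x # us @ zs) \<longleftrightarrow> shallow_list (x # us @ xs @ e # ys) \<and>
            ((\<forall>u\<in>set (x # xs). u < e) \<or> (\<forall>v\<in>set ys. e < v))"
          using 2 lt \<open>x < M\<close> shallow_list_max[of "x # us @ xs" e ys M] by auto
        moreover have "shallow_list (x # zs) \<longleftrightarrow> shallow_list (x # xs @ e # ys) \<and>
            ((\<forall>u\<in>set (x # xs). u < e) \<or> (\<forall>v\<in>set ys. e < v))"
          using 2 \<open>x < M\<close> shallow_list_max[of "x # xs" e ys M] by auto
        moreover have "shallow_list (x # us @ xs @ e # ys) \<longleftrightarrow>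
            shallow_list (x # us) \<and> shallow_list (x # xs @ e # ys)"
          using less.prems 2 by (intro less.hyps) auto
        ultimately show ?thesis by blast
      qed
    qed
  qed
qed

text \<open>The mirror image of a \<open>step\<close>, where the minimum is removed instead of the maximum.\<close>

lemma shallow_list_min:
  assumes "shallow_list (x # us @ m # vs)" "\<forall>y\<in>set (x # us @ vs). m < y"
  shows "shallow_list (us @ x # vs) \<and> ((\<forall>u\<in>set us. u < x) \<or> (\<forall>v\<in>set vs. x < v))"
  using assms
proof (induction "length us + length vs" arbitrary: us x vs rule: less_induct)
  case less
  have dist: "distinct (x # us @ m # vs)"
    using less.prems(1) by (rule shallow_list_distinct)
  \<comment> \<open>The maximum is removed, the induction hypothesis then removes \<open>m\<close>,
    and the maximum is put back. The cases are its three possible places: at \<open>x\<close>,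
    between \<open>x\<close> and \<open>m\<close>, or after \<open>m\<close>.\<close>
  define M where "M = Max (set (x # us @ vs))"
  have "M \<in> set (x # us @ vs)"
    unfolding M_def by (rule Max_in) auto
  have le: "y \<le> M" if "y \<in> set (x # us @ vs)" for y
    unfolding M_def using that by simp
  have lt: "y < M" if "y \<in> set (x # us @ vs)" "y \<noteq> M" for y
    using le[OF that(1)] that(2) by simp
  have "m < M"
    using less.prems(2) \<open>M \<in> _\<close> by blast
  consider "M = x" | "M \<in> set us" | "M \<in> set vs"
    using \<open>M \<in> _\<close> by auto
  then show ?case
  proof cases
    case 1
    then have small: "\<forall>u\<in>set (us @ vs). u < x"
      using lt dist by auto
    show ?thesis
    proof (cases vs rule: rev_cases)
      case Nil
      \<comment> \<open>Removing \<open>x\<close> moves \<open>m\<close> to the front, where it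
        splits off as the lower summand.\<close>
      have "shallow_list (m # us)"
        using less.prems(1) shallow_list_Cons_max[of us m x] small Nil 1 \<open>m < M\<close> by auto
      then have "shallow_list ([m] @ us)" by simp
      then have "shallow_list us"
        using shallow_list_append[of "[m]" us] less.prems(2) dist by auto
      then show ?thesis
        using Nil small shallow_list_snoc_max[of us x] by auto
    next
      case (snoc vs' e)
      have "shallow_list (e # us @ m # vs')"
        using less.prems(1) shallow_list_Cons_max[of "us @ m # vs'" e x] small snoc 1 \<open>m < M\<close> by auto
      then have "shallow_list (us @ e # vs') \<and> ((\<forall>u\<in>set us. u < e) \<or> (\<forall>v\<in>set vs'. e < v))"
        using less.hyps[of us vs' e] less.prems(2) snoc by auto
      then show ?thesis
        using shallow_list_max[of us e vs' x] small snoc by auto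
    qed
  next
    case 2
    then obtain u1 u2 where us: "us = u1 @ M # u2"
      by (meson split_list)
    show ?thesis
    proof (cases vs rule: rev_cases)
      case Nil
      have "shallow_list ((x # u1) @ m # u2)"
        using less.prems(1) shallow_list_max[of "x # u1" m u2 M] us Nil dist lt \<open>m < M\<close> by auto
      then have "shallow_list (u1 @ x # u2) \<and> ((\<forall>u\<in>set u1. u < x) \<or> (\<forall>v\<in>set u2. x < v))"
        using less.hyps[of u1 u2 x] less.prems(2) us Nil by auto
      then show ?thesis
        using shallow_list_max[of u1 x u2 M] us Nil dist lt by auto
    next
      case (snoc vs' e)
      have "shallow_list ((x # u1) @ e # u2 @ m # vs')"
        and cond: "(\<forall>u\<in>set (x # u1). u < e) \<or> (\<forall>v\<in>set (u2 @ m # vs'). e < v)"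
        using less.prems(1) shallow_list_max[of "x # u1" e "u2 @ m # vs'" M] us snoc dist lt \<open>m < M\<close>
        by auto
      \<comment> \<open>The smaller entry \<open>m\<close> to the right of \<open>e\<close> rules
        out the second alternative, so \<open>e\<close> exceeds everything to its left.\<close>
      then have "x < e" "\<forall>u\<in>set u1. u < e"
        using less.prems(2) snoc by (auto dest: less_asym)
      have "shallow_list ((u1 @ e # u2) @ x # vs') \<and>
          ((\<forall>u\<in>set (u1 @ e # u2). u < x) \<or> (\<forall>v\<in>set vs'. x < v))"
        using less.hyps[of "u1 @ e # u2" vs' x] \<open>shallow_list ((x # u1) @ e # u2 @ m # vs')\<close>
          less.prems(2) us snoc by auto
      \<comment> \<open>The larger entry \<open>e\<close> now stands to the left of
        \<open>x\<close>, so \<open>x\<close> can only be a right-to-left minimum.\<close>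
      then have "shallow_list (u1 @ e # u2 @ x # vs')" "\<forall>v\<in>set vs'. x < v"
        using \<open>x < e\<close> by (auto dest: less_asym)
      then show ?thesis
        using shallow_list_max[of u1 e "u2 @ x # vs'" M] us snoc dist lt \<open>x < e\<close> \<open>\<forall>u\<in>set u1. u < e\<close>
        by auto
    qed
  next
    case 3
    then obtain v1 v2 where vs: "vs = v1 @ M # v2"
      by (meson split_list)
    show ?thesis
    proof (cases v2 rule: rev_cases)
      case Nil
      have "shallow_list (x # us @ m # v1)"
        using less.prems(1) shallow_list_snoc_max[of "x # us @ m # v1" M] vs Nil dist lt \<open>m < M\<close> by auto
      then have "shallow_list (us @ x # v1) \<and> ((\<forall>u\<in>set us. u < x) \<or> (\<forall>v\<in>set v1. x < v))"
        using less.hyps[of us v1 x] less.prems(2) vs Nil by auto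
      then show ?thesis
        using shallow_list_snoc_max[of "us @ x # v1" M] vs Nil dist lt by auto
    next
      case (snoc v3 e)
      have "shallow_list (x # us @ m # v1 @ e # v3)"
        and cond: "(\<forall>u\<in>set (x # us @ m # v1). u < e) \<or> (\<forall>v\<in>set v3. e < v)"
        using less.prems(1) shallow_list_max[of "x # us @ m # v1" e v3 M] vs snoc dist lt \<open>m < M\<close>
        by auto
      \<comment> \<open>Moving \<open>x\<close> into the place of \<open>m\<close> happens to the
        left of \<open>e\<close>, so \<open>cond\<close> still allows \<open>M\<close> to be put
        back.\<close>
      then have "shallow_list (us @ x # v1 @ e # v3) \<and>
          ((\<forall>u\<in>set us. u < x) \<or> (\<forall>v\<in>set (v1 @ e # v3). x < v))"
        using less.hyps[of us "v1 @ e # v3" x] less.prems(2) vs snoc by auto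
      then show ?thesis
        using shallow_list_max[of "us @ x # v1" e v3 M] vs snoc dist lt cond by auto
    qed
  qed
qed

text \<open>If \<open>x\<close> is the maximum, its removal again leaves one entry in front of a
  decreasing list. Otherwise the maximum is the head of \<open>ds\<close>, and the last entry of
  \<open>ds\<close> replaces it as a right-to-left minimum.\<close>

lemma shallow_list_Cons_decreasing:
  assumes "sorted_wrt (>) ds" "x \<notin> set ds"
  shows "shallow_list (x # ds)"
  using assms
proof (induction "length ds" arbitrary: x ds rule: less_induct)
  case less
  show ?case
  proof (cases "\<forall>d\<in>set ds. d < x")
    case True
    show ?thesis
    proof (cases ds rule: rev_cases)
      case (snoc ds' e)
      then have "shallow_list (e # ds')"
        using less by (auto simp: sorted_wrt_append)
      then show ?thesis
        using snoc True shallow_list_Cons_max[of ds' e x] by auto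
    qed simp
  next
    case False
    then obtain M ds' where ds: "ds = M # ds'"
      by (cases ds) auto
    then have "x < M"
      using False less.prems by (auto simp: not_less dest: le_less_trans)
    show ?thesis
    proof (cases ds' rule: rev_cases)
      case Nil
      then show ?thesis
        using ds \<open>x < M\<close> shallow_list_snoc_max[of "[x]" M] by simp
    next
      case (snoc ds'' e)
      have IH: "shallow_list (e # ds'')" "shallow_list (x # ds'')"
        using less ds snoc by (auto simp: sorted_wrt_append)
      \<comment> \<open>If \<open>e < x\<close>, then \<open>e\<close> is below everything else and
        decouples; otherwise \<open>x\<close> is the smallest entry and splits off as the lower
        summand.\<close>
      have "shallow_list (x # e # ds'')"
      proof (cases "e < x")
        case True
        then have "shallow_list [x, e]"
          using shallow_list_Cons_max[of "[]" e x] by simp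
        then show ?thesis
          using shallow_list_Cons_append[of "[e]" x ds''] True IH(2) less.prems ds snoc shallow_list_distinct[OF IH(2)]
          by (auto simp: sorted_wrt_append)
      next
        case False
        then have "\<forall>v\<in>set (e # ds''). x < v"
          using less.prems ds snoc by (auto simp: sorted_wrt_append not_less order.strict_iff_order)
        then show ?thesis
          using shallow_list_append[of "[x]" "e # ds''"] IH(1) shallow_list_distinct[OF IH(1)] by auto
      qed
      then show ?thesis
        using shallow_list_max[of "[x]" e ds'' M] ds snoc \<open>x < M\<close> less.prems
        by (auto simp: sorted_wrt_append)
    qed
  qed
qed

lemma shallow_list_decreasing: "sorted_wrt (>) ds \<Longrightarrow> shallow_list ds"
  by (cases ds) (auto intro: shallow_list_Cons_decreasing shallow_list.Nil)

lemma shallow_list_increasing: "sorted_wrt (<) as \<Longrightarrow> shallow_list as"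
  by (induction as rule: rev_induct) (auto simp: sorted_wrt_append intro: shallow_list.intros)

text \<open>Each removal of the maximum moves \<open>m\<close> one place to the left. Nothing
  follows \<open>m\<close>, so the last premise of \<open>step\<close> holds vacuously.\<close>

lemma shallow_list_increasing_snoc:
  assumes "sorted_wrt (<) as" "\<forall>a\<in>set as. m < a"
  shows "shallow_list (as @ [m])"
proof (cases as rule: rev_cases)
  case (snoc as' a)
  have "shallow_list (as' @ [m])"
    using assms snoc 
  proof (induction as' arbitrary: as a rule: rev_induct)
    case (snoc b as')
    then show ?case
      using shallow_list_max[of as' m "[]" b] by (auto simp: sorted_wrt_append)
  qed simp
  then show ?thesis
    using shallow_list_max[of as' m "[]" a] assms snoc by (auto simp: sorted_wrt_append)
qed simp

text \<open>While \<open>cs\<close> is nonempty, each removal of the maximum moves the last entry of \<open>cs\<close>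
  to the end of \<open>as\<close>.\<close>

lemma shallow_list_decreasing_with_min:
  assumes "sorted_wrt (<) as" "sorted_wrt (>) (bs @ cs)"
    "\<forall>a\<in>set as. \<forall>b\<in>set (bs @ cs). a < b" "\<forall>y\<in>set (as @ bs @ cs). m < y"
  shows "shallow_list (as @ bs @ m # cs)"
  using assms
proof (induction "length bs + length cs" arbitrary: as bs cs rule: less_induct)
  case less
  show ?case
  proof (cases bs)
    case Nil
    have "shallow_list cs"
      using less.prems Nil by (intro shallow_list_decreasing) simp
    moreover have "shallow_list (as @ [m])"
      using less.prems by (intro shallow_list_increasing_snoc) auto
    ultimately show ?thesis
      using shallow_list_append[of "as @ [m]" cs] less.prems Nil shallow_list_distinct[of cs] by auto
  next
    case (Cons M bs')
    show ?thesis
    proof (cases cs rule: rev_cases)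
      case Nil
      have "shallow_list bs'"
        using less.prems Cons Nil by (intro shallow_list_decreasing) simp
      moreover have "shallow_list (as @ [m])"
        using less.prems by (intro shallow_list_increasing_snoc) auto
      ultimately have "shallow_list (as @ m # bs')"
        using shallow_list_append[of "as @ [m]" bs'] less.prems Cons Nil shallow_list_distinct[of bs'] by auto
      then show ?thesis
        using shallow_list_max[of as m bs' M] less.prems Cons Nil by auto
    next
      case (snoc cs' e)
      have "shallow_list ((as @ [e]) @ bs' @ m # cs')"
        using less.prems Cons snoc by (intro less.hyps) (auto simp: sorted_wrt_append)
      then show ?thesis
        using shallow_list_max[of as e "bs' @ m # cs'" M] less.prems Cons snoc
        by (auto simp: sorted_wrt_append)
    qed
  qed
qed

subsection \<open>231-avoiding lists\<close>

text \<open>The recursion runs over the entry that plays the 2; \<open>y\<close> and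
  \<open>z\<close> play the 3 and the 1.\<close>

fun avoids231 :: "'a::linorder list \<Rightarrow> bool" where
  "avoids231 [] \<longleftrightarrow> True"
| "avoids231 (x # xs) \<longleftrightarrow> sorted_wrt (\<lambda>y z. \<not> (z < x \<and> x < y)) xs \<and> avoids231 xs"

text \<open>An occurrence of 231 that meets both parts has either its first entry or its first two
  entries in \<open>us\<close>.\<close>

lemma avoids231_append:
  "avoids231 (us @ vs) \<longleftrightarrow> avoids231 us \<and> avoids231 vs \<and>
    (\<forall>u\<in>set us. sorted_wrt (\<lambda>y z. \<not> (z < u \<and> u < y)) vs) \<and>
    (\<forall>v\<in>set vs. sorted_wrt (\<lambda>x y. \<not> (v < x \<and> x < y)) us)"
  by (induction us) (auto simp: sorted_wrt_append)

lemma sorted_wrt_if_all: "(\<And>x y. x \<in> set xs \<Longrightarrow> y \<in> set xs \<Longrightarrow> P x y) \<Longrightarrow> sorted_wrt P xs"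
  by (induction xs) auto

text \<open>The maximum can only play the 3, so nothing before it may exceed anything after it;
  conversely, no occurrence can then straddle \<open>M\<close>. This is the source of the
  decomposition into summands.\<close>

lemma avoids231_max:
  assumes "\<forall>y\<in>set (us @ vs). y < M"
  shows "avoids231 (us @ M # vs) \<longleftrightarrow>
    avoids231 us \<and> avoids231 vs \<and> (\<forall>u\<in>set us. \<forall>v\<in>set vs. u \<le> v)"
    (is "?lhs \<longleftrightarrow> ?rhs")
proof
  assume L: ?lhs
  then have "\<forall>u\<in>set us. \<forall>v\<in>set vs. \<not> (v < u \<and> u < M)"
    by (auto simp: avoids231_append)
  then have "\<forall>u\<in>set us. \<forall>v\<in>set vs. u \<le> v"
    using assms by (simp add: not_less)
  then show ?rhs
    using L by (simp add: avoids231_append)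
next
  assume R: ?rhs
  have "sorted_wrt (\<lambda>y z. \<not> (z < u \<and> u < y)) vs" if "u \<in> set us" for u
    using R that by (intro sorted_wrt_if_all) (auto simp: not_less)
  moreover have "sorted_wrt (\<lambda>x y. \<not> (v < x \<and> x < y)) us" if "v \<in> set vs" for v
    using R that by (intro sorted_wrt_if_all) (auto simp: not_less)
  moreover have "sorted_wrt (\<lambda>y z. \<not> (z < M \<and> M < y)) vs"
    using assms by (intro sorted_wrt_if_all) (auto dest: less_asym)
  moreover have "sorted_wrt (\<lambda>x y. \<not> (M < x \<and> x < y)) us"
    using assms by (intro sorted_wrt_if_all) (auto dest: less_asym)
  ultimately show ?lhs
    using R assms by (auto simp: avoids231_append not_less)
qed

lemma avoids231_map:
  fixes f :: "'a::linorder \<Rightarrow> 'b::linorder"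
  assumes "strict_mono_on (set xs) f"
  shows "avoids231 (map f xs) \<longleftrightarrow> avoids231 xs"
  using assms
proof (induction xs)
  case (Cons x xs)
  then have "strict_mono_on (set xs) f"
    by (auto simp: strict_mono_on_def)
  moreover have "sorted_wrt (\<lambda>y z. \<not> (z < f x \<and> f x < y)) (map f xs) \<longleftrightarrow>
      sorted_wrt (\<lambda>y z. \<not> (z < x \<and> x < y)) xs"
    unfolding sorted_wrt_map
    using strict_mono_on_less[OF Cons.prems] by (auto simp: sorted_wrt_iff_nth_less)
  ultimately show ?case
    using Cons.IH by simp
qed simp

text \<open>A decreasing block contains no ascent, so an occurrence must have its 2 in
  \<open>us\<close> and its 3 and 1 in \<open>vs\<close>.\<close>

lemma avoids231_decreasing_append:
  assumes "sorted_wrt (>) us" "sorted_wrt (>) vs"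
    "\<forall>u\<in>set us. \<forall>y\<in>set vs. \<forall>z\<in>set vs. \<not> (z < u \<and> u < y)"
  shows "avoids231 (us @ vs)"
proof -
  have *: "avoids231 xs" if "sorted_wrt (>) xs" for xs :: "'a list"
    using that
  proof (induction xs)
    case (Cons x xs)
    then show ?case
      by (auto intro: sorted_wrt_mono_rel[of xs "(>)"] dest: less_asym)
  qed simp
  show ?thesis
    using assms *[of us] *[of vs]
    by (auto simp: avoids231_append intro: sorted_wrt_mono_rel[of us "(>)"] sorted_wrt_mono_rel[of vs "(>)"])
qed

text \<open>An ascent in \<open>us\<close> followed by the smaller entry \<open>v\<close> would be a
  231.\<close>

lemma avoids231_imp_decreasing:
  assumes "avoids231 (us @ vs)" "v \<in> set vs" "\<forall>u\<in>set us. v < u" "distinct us"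
  shows "sorted_wrt (>) us"
proof -
  have "sorted_wrt (\<lambda>x y. \<not> (v < x \<and> x < y)) us"
    using assms(1,2) by (simp add: avoids231_append)
  then show ?thesis
    using assms(3,4) by (induction us) (auto simp: order.strict_iff_order not_less)
qed

section \<open>Decreasing intervals and the classification of \<open>tails\<close>\<close>

definition decr :: "nat \<Rightarrow> nat \<Rightarrow> nat list" where
  "decr a b = rev [a..<b]"

lemma set_decr [simp]: "set (decr a b) = {a..<b}"
  and length_decr [simp]: "length (decr a b) = b - a"
  and decr_eq_Nil [simp]: "decr a b = [] \<longleftrightarrow> b \<le> a"
  by (auto simp: decr_def)

lemma sorted_decr: "sorted_wrt (>) (decr a b)"
  unfolding decr_def sorted_wrt_rev by simp

lemma decr_snoc: "a < b \<Longrightarrow> decr a b = decr (Suc a) b @ [a]"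
  by (simp add: decr_def upt_rec)

lemma decr_append: "a \<le> b \<Longrightarrow> b \<le> c \<Longrightarrow> decr b c @ decr a b = decr a c"
  unfolding decr_def by (metis le_add_diff_inverse rev_append upt_add_eq_append)

lemma decr_unique:
  assumes "sorted_wrt (>) xs" "set xs = {a..<b}"
  shows "xs = decr a b"
proof -
  have "rev xs = [a..<b]"
    using assms by (intro strict_sorted_equal) (simp_all add: sorted_wrt_rev)
  then show ?thesis
    by (metis decr_def rev_rev_ident)
qed

text \<open>The lists that can follow the entries \<open>l + 2, l + 1\<close> at the start of a shallow
  231-avoiding permutation of \<open>{1..l + 2}\<close>; avoidance needs to be required of the rest only.\<close>

definition tails :: "nat \<Rightarrow> nat list set" where
  "tails l = {vs. set vs = {1..l} \<and> avoids231 vs \<and> shallow_list ((l + 2) # (l + 1) # vs)}"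

text \<open>The families \<open>tail1\<close> and \<open>tail2\<close> are indexed by their last
  entry. A member of \<open>tail3\<close> is the list \<open>l, ..., 2\<close> with 1 inserted just
  before \<open>j\<close>.\<close>

definition tail1 :: "nat \<Rightarrow> nat \<Rightarrow> nat list" where
  "tail1 l c = decr 1 c @ decr c (Suc l)"

definition tail2 :: "nat \<Rightarrow> nat \<Rightarrow> nat list" where
  "tail2 l c = (decr (Suc c) (Suc l) @ decr 1 c) @ [c]"

definition tail3 :: "nat \<Rightarrow> nat \<Rightarrow> nat list" where
  "tail3 l j = (decr (Suc j) (Suc l) @ [1]) @ decr 2 (Suc j)"

text \<open>Removing \<open>l + 2\<close> brings \<open>c\<close> to the front; if
  \<open>c < l\<close>, removing \<open>l + 1\<close> then puts \<open>c + 1\<close> in its place.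
  What remains is the direct sum of \<open>c, c + 1, c - 1, ..., 1\<close> and a decreasing
  block.\<close>

lemma tail1_in_tails:
  assumes "c \<in> {1..l}"
  shows "tail1 l c \<in> tails l"
proof -
  \<comment> \<open>For \<open>c \<ge> 2\<close>, removing \<open>k\<close> moves 1 right behind
    \<open>c\<close>, where it decouples from the decreasing rest.\<close>
  have core: "shallow_list (c # k # decr 1 c)" if "c < k" for k
  proof (cases "c = 1")
    case True
    then show ?thesis
      using that by (simp add: decr_def shallow_list_increasing)
  next
    case False
    have 1: "decr 1 c = decr 2 c @ [1]"
      using False assms decr_snoc[of 1 c] by (simp add: numeral_2_eq_2)
    have "shallow_list (c # [1] @ decr 2 c)"
      using shallow_list_Cons_append[of "[1]" c "decr 2 c"] shallow_list_Cons_max[of "[]" 1 c]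
        shallow_list_Cons_decreasing[OF sorted_decr, of c 2 c]
        shallow_list_distinct[OF shallow_list_decreasing[OF sorted_decr]] False assms by auto
    then show ?thesis
      using shallow_list_max[of "[c]" 1 "decr 2 c" k] that False assms 1 by auto
  qed
  have "shallow_list (c # (l + 1) # decr 1 c @ decr (Suc c) (Suc l))"
  proof (cases "c = l")
    case True
    then show ?thesis
      using core[of "l + 1"] True by (simp add: decr_def)
  next
    case False
    then have 2: "decr (Suc c) (Suc l) = decr (c + 2) (Suc l) @ [Suc c]"
      using assms decr_snoc[of "Suc c" "Suc l"] by simp
    have "shallow_list ((c # Suc c # decr 1 c) @ decr (c + 2) (Suc l))"
      using core[of "Suc c"] shallow_list_decreasing[OF sorted_decr, of "c + 2" "Suc l"]
      by (subst shallow_list_append) (auto intro: shallow_list_distinct)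
    moreover have "\<forall>u\<in>set ([c] @ Suc c # decr 1 c @ decr (c + 2) (Suc l)). u < l + 1"
      using False assms by auto
    from shallow_list_max[OF this]
    have "shallow_list (c # (l + 1) # (decr 1 c @ decr (c + 2) (Suc l)) @ [Suc c]) \<longleftrightarrow>
        shallow_list (c # Suc c # decr 1 c @ decr (c + 2) (Suc l))" by simp
    ultimately show ?thesis
      unfolding 2 by simp
  qed
  moreover have "decr c (Suc l) = decr (Suc c) (Suc l) @ [c]"
    using assms by (intro decr_snoc) simp
  moreover have "\<forall>v\<in>set (((l + 1) # decr 1 c @ decr (Suc c) (Suc l)) @ [c]). v < l + 2"
    using assms by auto
  note shallow_list_Cons_max[OF this]
  ultimately have "shallow_list ((l + 2) # (l + 1) # tail1 l c)"
    by (simp add: tail1_def)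
  moreover have "avoids231 (tail1 l c)"
    unfolding tail1_def by (rule avoids231_decreasing_append) (auto intro: sorted_decr)
  moreover have "set (tail1 l c) = {1..l}"
    using assms by (auto simp: tail1_def)
  ultimately show ?thesis
    by (simp add: tails_def)
qed

text \<open>Removing \<open>l + 2\<close> leaves \<open>c\<close> in front of a decreasing
  list.\<close>

lemma tail2_in_tails:
  assumes "c \<in> {2..<l}"
  shows "tail2 l c \<in> tails l"
proof -
  have sorted: "sorted_wrt (>) (decr (Suc c) (Suc l) @ decr 1 c)"
    by (auto simp: sorted_wrt_append sorted_decr)
  then have "shallow_list (c # (l + 1) # decr (Suc c) (Suc l) @ decr 1 c)"
    using assms by (intro shallow_list_Cons_decreasing) auto
  moreover have "\<forall>v\<in>set (((l + 1) # decr (Suc c) (Suc l) @ decr 1 c) @ [c]). v < l + 2"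
    using assms by auto
  ultimately have "shallow_list ((l + 2) # (l + 1) # tail2 l c)"
    using shallow_list_Cons_max[of "(l + 1) # decr (Suc c) (Suc l) @ decr 1 c" c "l + 2"]
    by (simp add: tail2_def)
  moreover have "avoids231 (tail2 l c)"
    unfolding tail2_def using sorted by (rule avoids231_decreasing_append) auto
  moreover have "set (tail2 l c) = {1..l}"
    using assms by (auto simp: tail2_def)
  ultimately show ?thesis
    by (simp add: tails_def)
qed

text \<open>With the two leading maxima, the list is decreasing except for the minimum 1 inserted
  into it.\<close>

lemma tail3_in_tails:
  assumes "j \<in> {3..<l}"
  shows "tail3 l j \<in> tails l"
proof -
  have "shallow_list ([] @ ((l + 2) # (l + 1) # decr (Suc j) (Suc l)) @ 1 # decr 2 (Suc j))"
    using assms by (intro shallow_list_decreasing_with_min) (auto simp: sorted_wrt_append sorted_decr)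
  then have "shallow_list ((l + 2) # (l + 1) # tail3 l j)"
    by (simp add: tail3_def)
  moreover have "avoids231 (tail3 l j)"
    unfolding tail3_def using assms
    by (intro avoids231_decreasing_append) (auto simp: sorted_wrt_append sorted_decr)
  moreover have "set (tail3 l j) = {1..l}"
    using assms by (auto simp: tail3_def)
  ultimately show ?thesis
    by (simp add: tails_def)
qed

lemma decreasing_eq_filter_append:
  fixes xs :: "'a::linorder list"
  assumes "sorted_wrt (>) xs" "c \<notin> set xs"
  shows "filter (\<lambda>x. c < x) xs @ filter (\<lambda>x. x < c) xs = xs"
  using assms
proof (induction xs)
  case (Cons x xs)
  show ?case
  proof (cases "c < x")
    case True
    then have "\<not> x < c" by (rule less_not_sym)
    then show ?thesis using Cons True by simp
  next
    case False
    then have "\<forall>y\<in>set (x # xs). y < c"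
      using Cons.prems by auto
    then show ?thesis
      by (auto simp: filter_empty_conv intro!: filter_True)
  qed
qed simp

text \<open>For \<open>c \<ge> 2\<close> write \<open>vs\<close> as \<open>v1, 1, v2, c\<close>.
  Shallowness puts \<open>v2\<close> above \<open>c\<close>, and avoidance makes \<open>v1\<close>
  and \<open>v2, c\<close> decreasing. Cutting \<open>v1\<close> at the value \<open>c\<close> gives
  \<open>B, S, 1, v2, c\<close>, where \<open>S, 1\<close> and \<open>B, v2, c\<close> are
  decreasing intervals. Shallowness also forbids that \<open>B\<close>, \<open>S\<close> and
  \<open>v2\<close> are all nonempty; the other cases are the three families.\<close>

lemma tails_cases:
  assumes "vs \<in> tails l" "l \<ge> 1"
  shows "vs \<in> tail1 l ` {1..l} \<union> tail2 l ` {2..<l} \<union> tail3 l ` {3..<l}"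
proof -
  have set: "set vs = {1..l}" and av: "avoids231 vs"
    and sh: "shallow_list ((l + 2) # (l + 1) # vs)"
    using assms by (auto simp: tails_def)
  have dist: "distinct vs"
    using shallow_list_distinct[OF sh] by simp
  have "vs \<noteq> []" using set assms(2) by auto
  then obtain vs' c where vs: "vs = vs' @ [c]"
    by (meson rev_exhaust)
  have c: "c \<in> {1..l}" and bound: "\<forall>v\<in>set vs'. 1 \<le> v \<and> v \<le> l"
    using set vs by auto
  have sh1: "shallow_list (c # (l + 1) # vs')"
  proof -
    have "\<forall>v\<in>set (((l + 1) # vs') @ [c]). v < l + 2"
      using c bound by auto
    from shallow_list_Cons_max[OF this] show ?thesis
      using sh vs by simp
  qed
  show ?thesis
  proof (cases "c = 1")
    case True
    then have "sorted_wrt (>) vs'"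
      using av vs dist bound by (intro avoids231_imp_decreasing[of vs' "[c]" c]) (auto simp: le_less)
    then have "vs = decr 1 (Suc l)"
      using True vs set dist bound
      by (intro decr_unique) (auto simp: sorted_wrt_append le_less)
    then have "vs = tail1 l 1"
      using True by (simp add: tail1_def decr_def)
    then show ?thesis using assms(2) by auto
  next
    case False
    then have "c \<ge> 2" using c by auto
    have "1 \<in> set vs'"
      using set vs False c by (auto simp: set_eq_iff)
    then obtain v1 v2 where vs': "vs' = v1 @ 1 # v2"
      by (meson split_list)
    have vs_split: "vs = v1 @ 1 # v2 @ [c]"
      using vs vs' by simp
    have gt1: "\<forall>y\<in>set (v1 @ v2). 1 < y"
      using bound vs' dist vs by (force simp: le_less)
    \<comment> \<open>When the minimum 1 is removed, \<open>l + 1\<close> stands before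
      \<open>c\<close> and exceeds it, so \<open>c\<close> has to be a right-to-left
      minimum.\<close>
    have "shallow_list (c # ((l + 1) # v1) @ 1 # v2)"
      using sh1 vs' by simp
    from shallow_list_min[OF this] have v2_gt: "\<forall>v\<in>set v2. c < v"
      using gt1 c \<open>c \<ge> 2\<close> by auto
    have sorted1: "sorted_wrt (>) v1"
      using av vs_split dist gt1 by (intro avoids231_imp_decreasing[of v1 "1 # v2 @ [c]" 1]) auto
    have "avoids231 (v2 @ [c])"
      using av vs_split by (auto simp: avoids231_append)
    then have sorted2: "sorted_wrt (>) (v2 @ [c])"
      using v2_gt dist vs_split avoids231_imp_decreasing[of v2 "[c]" c] by (auto simp: sorted_wrt_append)
    define B where "B = filter (\<lambda>x. c < x) v1"
    define S where "S = filter (\<lambda>x. x < c) v1"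
    have v1: "v1 = B @ S"
      unfolding B_def S_def using sorted1 dist vs_split
      by (intro decreasing_eq_filter_append[symmetric]) auto
    have B_gt: "y < b" if "b \<in> set B" "y \<in> set v2" for b y
    proof -
      \<comment> \<open>Otherwise \<open>b, y, c\<close> would be a 231.\<close>
      have "sorted_wrt (\<lambda>y z. \<not> (z < b \<and> b < y)) (v2 @ [c])"
        using av vs_split that(1) v1 by (auto simp: avoids231_append sorted_wrt_append)
      then have "\<not> (c < b \<and> b < y)"
        using that(2) by (auto simp: sorted_wrt_append)
      moreover have "c < b" "b \<noteq> y"
        using that dist vs_split by (auto simp: B_def)
      ultimately show ?thesis by simp
    qed
    have B_c: "\<forall>b\<in>set B. c < b" and S_c: "\<forall>s\<in>set S. s < c"
      by (auto simp: B_def S_def)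
    have mem: "y \<in> set B \<or> y \<in> set S \<or> y = 1 \<or> y = c \<or> y \<in> set v2 \<longleftrightarrow> 1 \<le> y \<and> y \<le> l" for y
    proof -
      have "y \<in> set vs \<longleftrightarrow> 1 \<le> y \<and> y \<le> l"
        using set by simp
      then show ?thesis
        unfolding vs_split v1 by auto
    qed
    have B_S_v2: "(y \<in> set B \<longrightarrow> c < y) \<and> (y \<in> set S \<longrightarrow> y < c) \<and> (y \<in> set v2 \<longrightarrow> c < y)" for y
      using B_c S_c v2_gt by blast
    have big: "B @ v2 @ [c] = decr c (Suc l)"
    proof (rule decr_unique)
      show "sorted_wrt (>) (B @ v2 @ [c])"
        using sorted1 v1 sorted2 B_gt B_c by (auto simp: sorted_wrt_append)
      show "set (B @ v2 @ [c]) = {c..<Suc l}"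
      proof (rule set_eqI)
        fix y
        have "y \<in> set B \<or> y = c \<or> y \<in> set v2 \<longleftrightarrow> c \<le> y \<and> y \<le> l"
          using mem[of y] B_S_v2[of y] c \<open>c \<ge> 2\<close> by auto
        then show "y \<in> set (B @ v2 @ [c]) \<longleftrightarrow> y \<in> {c..<Suc l}"
          by auto
      qed
    qed
    have small: "S @ [1] = decr 1 c"
    proof (rule decr_unique)
      show "sorted_wrt (>) (S @ [1])"
        using sorted1 v1 gt1 by (auto simp: sorted_wrt_append)
      show "set (S @ [1]) = {1..<c}"
      proof (rule set_eqI)
        fix y
        have "y \<in> set S \<or> y = 1 \<longleftrightarrow> 1 \<le> y \<and> y < c"
          using mem[of y] B_S_v2[of y] c \<open>c \<ge> 2\<close> by auto
        then show "y \<in> set (S @ [1]) \<longleftrightarrow> y \<in> {1..<c}"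
          by auto
      qed
    qed
    have vs_eq: "vs = B @ (S @ [1]) @ v2 @ [c]"
      using vs_split v1 by simp
    consider "v2 = []" | "B = []" | "v2 \<noteq> []" "B \<noteq> []" "S \<noteq> []" | "v2 \<noteq> []" "B \<noteq> []" "S = []"
      by blast
    then show ?thesis
    proof cases
      case 1
      have "decr c (Suc l) = decr (Suc c) (Suc l) @ [c]"
        using c by (intro decr_snoc) simp
      then have B: "B = decr (Suc c) (Suc l)"
        using big 1 by simp
      show ?thesis
      proof (cases "c = l")
        case True
        then have "B = []" using B by simp
        then have "vs = tail1 l c"
          using vs_eq small big by (simp add: tail1_def)
        then show ?thesis using c by blast
      next
        case False
        then have "vs = tail2 l c"
          using vs_eq small B 1 by (simp add: tail2_def)
        then show ?thesis using c \<open>c \<ge> 2\<close> False by auto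
      qed
    next
      case 2
      then have "vs = tail1 l c"
        using vs_eq small big by (simp add: tail1_def)
      then show ?thesis using c by blast
    next
      case 3
      obtain w d where v2: "v2 = w @ [d]"
        using 3(1) by (meson rev_exhaust)
      obtain S' m where S: "S = S' @ [m]"
        using 3(3) by (meson rev_exhaust)
      \<comment> \<open>Removed in turn are the maximum \<open>l + 1\<close>, the minimum 1 and the
        next minimum \<open>m\<close>. The last removal moves \<open>d\<close> behind
        \<open>B\<close> and \<open>S'\<close>, which requires \<open>d\<close> above all of
        \<open>B\<close> or below \<open>c\<close>; but \<open>d\<close> lies above \<open>c\<close>
        and below \<open>B\<close>.\<close>
      have "shallow_list ([c] @ (l + 1) # (B @ S @ 1 # w) @ [d])"
        using sh1 vs' v1 v2 by simp
      moreover have "\<forall>u\<in>set ([c] @ d # B @ S @ 1 # w). u < l + 1"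
        using c bound unfolding vs' v1 v2 by (auto simp: less_Suc_eq_le)
      note shallow_list_max[OF this]
      ultimately have sh2: "shallow_list (c # (d # B @ S) @ 1 # w)"
        by simp
      have "\<forall>y\<in>set (c # (d # B @ S) @ w). 1 < y"
        using gt1 \<open>c \<ge> 2\<close> unfolding v1 v2 by auto
      from shallow_list_min[OF sh2 this] have "shallow_list ((d # B @ S) @ c # w)"
        by blast
      then have sh3: "shallow_list (d # (B @ S') @ m # c # w)"
        using S by simp
      have "m < c" using S S_c by simp
      have "m < y" if "y \<in> set S'" for y
        using sorted1 v1 S that by (auto simp: sorted_wrt_append)
      then have "\<forall>y\<in>set (d # (B @ S') @ c # w). m < y"
        using \<open>m < c\<close> B_c v2_gt v2 by auto
      from shallow_list_min[OF sh3 this] have "(\<forall>b\<in>set B. b < d) \<or> d < c"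
        by auto
      moreover have "\<forall>b\<in>set B. d < b" "c < d"
        using B_gt v2 v2_gt by auto
      ultimately show ?thesis
        using 3(2) by (cases B) auto
    next
      case 4
      \<comment> \<open>With \<open>S\<close> empty, 1 is the only value below \<open>c\<close>, so
        \<open>c = 2\<close>; the cut between \<open>B\<close> and \<open>v2\<close> is the one
        remaining parameter.\<close>
      have "length (S @ [1]) = length (decr 1 c)"
        by (simp only: small)
      then have "c = 2"
        using 4(3) by simp
      have "length (B @ v2 @ [c]) = length (decr c (Suc l))"
        by (simp only: big)
      then have len: "length B + length v2 + 1 = l - 1"
        using \<open>c = 2\<close> by simp
      define j where "j = l - length B"
      have "length B > 0" "length v2 > 0" using 4 by auto
      then have j: "3 \<le> j" "j < l"
        using len unfolding j_def by linarith+
      have "decr (Suc j) (Suc l) @ decr 2 (Suc j) = decr 2 (Suc l)"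
        using j by (intro decr_append) auto
      then have "B @ v2 @ [c] = decr (Suc j) (Suc l) @ decr 2 (Suc j)"
        using big \<open>c = 2\<close> by simp
      moreover have "length B = length (decr (Suc j) (Suc l))"
        using len by (simp add: j_def)
      ultimately have "B = decr (Suc j) (Suc l) \<and> v2 @ [c] = decr 2 (Suc j)"
        by (metis append_eq_append_conv)
      then have "vs = tail3 l j"
        unfolding vs_eq tail3_def 4(3) by simp
      then show ?thesis using j by auto
    qed
  qed
qed

text \<open>The ranges omit the values where the families meet: \<open>tail2\<close> at
  \<open>c = 1\<close> and \<open>c = l\<close> and \<open>tail3\<close> at \<open>j = l\<close>
  give members of \<open>tail1\<close>, and \<open>tail3\<close> at \<open>j = 2\<close> is
  \<open>tail2\<close> at \<open>c = 2\<close>.\<close>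

lemma tails_eq:
  assumes "l \<ge> 1"
  shows "tails l = tail1 l ` {1..l} \<union> tail2 l ` {2..<l} \<union> tail3 l ` {3..<l}"
proof
  show "tails l \<subseteq> tail1 l ` {1..l} \<union> tail2 l ` {2..<l} \<union> tail3 l ` {3..<l}"
    using tails_cases[OF _ assms] by (rule subsetI)
  show "tail1 l ` {1..l} \<union> tail2 l ` {2..<l} \<union> tail3 l ` {3..<l} \<subseteq> tails l"
    using tail1_in_tails tail2_in_tails tail3_in_tails by (simp add: image_subset_iff)
qed

subsection \<open>Counting\<close>

lemma tails_0: "tails 0 = {[]}"
  using shallow_list_Cons_max[of "[]" "1::nat" 2] by (auto simp: tails_def numeral_2_eq_2)

text \<open>The last entry and the number \<open>pos\<close> of entries before 1 tell all members
  apart. Truncated subtraction gives the right size 0 for the ranges that are empty for small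
  \<open>l\<close>.\<close>

lemma card_tails:
  assumes "l \<ge> 1"
  shows "card (tails l) = l + (l - 2) + (l - 3)"
proof -
  define pos where "pos xs = length (takeWhile (\<lambda>x. x \<noteq> 1) xs)" for xs :: "nat list"
  have pos: "pos (us @ 1 # vs) = length us" if "1 \<notin> set us" for us vs
  proof -
    have "takeWhile (\<lambda>x. x \<noteq> 1) (us @ 1 # vs) = us @ takeWhile (\<lambda>x. x \<noteq> 1) (1 # vs)"
      using that by (intro takeWhile_append2) auto
    then show ?thesis by (simp add: pos_def)
  qed
  have decr1: "decr 1 c = decr 2 c @ [1]" if "c \<ge> 2" for c
    using decr_snoc[of 1 c] that by (simp add: numeral_2_eq_2)
  have last1: "last (tail1 l c) = c" if "c \<in> {1..l}" for c
    using decr_snoc[of c "Suc l"] that by (simp add: tail1_def)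
  have pos1: "pos (tail1 l c) = c - 2" if "c \<in> {2..l}" for c
    using pos[of "decr 2 c" "decr c (Suc l)"] decr1[of c] that by (simp add: tail1_def)
  have last2: "last (tail2 l c) = c" for c
    by (simp add: tail2_def)
  have pos2: "pos (tail2 l c) = l - 2" if "c \<in> {2..<l}" for c
    using pos[of "decr (Suc c) (Suc l) @ decr 2 c" "[c]"] decr1[of c] that by (simp add: tail2_def)
  have last3: "last (tail3 l j) = 2" if "j \<in> {3..<l}" for j
    using decr_snoc[of 2 "Suc j"] that by (simp add: tail3_def)
  have pos3: "pos (tail3 l j) = l - j" if "j \<in> {3..<l}" for j
    using pos[of "decr (Suc j) (Suc l)" "decr 2 (Suc j)"] that by (simp add: tail3_def)
  have "inj_on (tail1 l) {1..l}" "inj_on (tail2 l) {2..<l}"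
    using last1 last2 by (auto intro!: inj_onI dest: arg_cong[of _ _ last])
  moreover have "inj_on (tail3 l) {3..<l}"
  proof (rule inj_onI)
    fix i j assume "i \<in> {3..<l}" "j \<in> {3..<l}" "tail3 l i = tail3 l j"
    then show "i = j" using pos3[of i] pos3[of j] by auto
  qed
  moreover have "tail1 l ` {1..l} \<inter> tail2 l ` {2..<l} = {}"
  proof -
    have False if "c \<in> {1..l}" "c' \<in> {2..<l}" "tail1 l c = tail2 l c'" for c c'
      using last1[of c] last2[of c'] pos1[of c] pos2[of c'] that by auto
    then show ?thesis by blast
  qed
  moreover have "(tail1 l ` {1..l} \<union> tail2 l ` {2..<l}) \<inter> tail3 l ` {3..<l} = {}"
  proof -
    have False if "c \<in> {1..l}" "j \<in> {3..<l}" "tail1 l c = tail3 l j" for c j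
      using last1[of c] last3[of j] pos1[of c] pos3[of j] that by auto
    moreover have False if "c \<in> {2..<l}" "j \<in> {3..<l}" "tail2 l c = tail3 l j" for c j
      using last2[of c] last3[of j] pos2[of c] pos3[of j] that by auto
    ultimately show ?thesis by blast
  qed
  ultimately show ?thesis
    unfolding tails_eq[OF assms] by (subst card_Un_disjoint; simp add: card_image)+
qed

text \<open>\<open>shallow_list\<close> forces distinct entries, so the members are permutations of
  \<open>{1..n}\<close>.\<close>

definition perm_lists :: "nat \<Rightarrow> nat list set" where
  "perm_lists n = {xs. set xs = {1..n} \<and> avoids231 xs \<and> shallow_list xs}"

text \<open>Avoidance is asked of \<open>ys\<close> only, because a leading maximum belongs to no
  occurrence of 231.\<close>

definition heads :: "nat \<Rightarrow> nat list set" where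
  "heads n = {ys. set ys = {1..<n} \<and> avoids231 ys \<and> shallow_list (n # ys)}"

lemma finite_perm_lists: "finite (perm_lists n)"
  by (rule finite_subset[OF _ finite_subset_distinct[of "{1..n}"]])
    (auto simp: perm_lists_def shallow_list_distinct)

lemma finite_heads: "finite (heads n)"
  by (rule finite_subset[OF _ finite_subset_distinct[of "{1..<n}"]])
    (auto simp: heads_def dest: shallow_list_distinct)

lemma finite_tails: "finite (tails n)"
  by (rule finite_subset[OF _ finite_subset_distinct[of "{1..n}"]])
    (auto simp: tails_def dest: shallow_list_distinct)

text \<open>Recovers the actual intervals from the order relation between the two parts, so that the
  upper part can be shifted down to start at 1.\<close>

lemma split_interval:
  fixes U W :: "nat set"
  assumes "U \<union> W = {a..<b}" "\<forall>u\<in>U. \<forall>w\<in>W. u < w" "a \<le> b"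
  shows "U = {a..<a + card U}" "W = {a + card U..<b}" "a + card U \<le> b"
proof -
  obtain m where m: "U = {a..<m}" "W = {m..<b}" "a \<le> m" "m \<le> b"
  proof (cases "W = {}")
    case True
    then show ?thesis using that[of b] assms by auto
  next
    case False
    have "finite W" using assms(1) by (metis finite_Un finite_atLeastLessThan)
    define m where "m = Min W"
    have m: "m \<in> W" "\<And>w. w \<in> W \<Longrightarrow> m \<le> w"
      using \<open>finite W\<close> False by (simp_all add: m_def)
    have mem: "x \<in> U \<or> x \<in> W \<longleftrightarrow> a \<le> x \<and> x < b" for x
      using assms(1) by (auto simp: set_eq_iff)
    have "a \<le> m" "m < b"
      using mem[of m] m(1) by auto
    have "x \<in> U \<longrightarrow> x < m" "x \<in> W \<longrightarrow> m \<le> x" for x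
      using assms(2) m by blast+
    then have "x \<in> U \<longleftrightarrow> x \<in> {a..<m}" "x \<in> W \<longleftrightarrow> x \<in> {m..<b}" for x
      using mem[of x] \<open>a \<le> m\<close> \<open>m < b\<close> by (metis atLeastLessThan_iff leD less_trans le_trans)+
    then have "U = {a..<m}" "W = {m..<b}"
      by blast+
    then show ?thesis using that[of m] \<open>a \<le> m\<close> \<open>m < b\<close> by simp
  qed
  then show "U = {a..<a + card U}" "W = {a + card U..<b}" "a + card U \<le> b"
    by simp_all
qed

lemma map_add_minus: "\<forall>w\<in>set ws. k \<le> w \<Longrightarrow> map (\<lambda>x. x + k) (map (\<lambda>x. x - k) ws) = ws"
  for k :: nat
  by (auto intro: map_idI)

lemma strict_mono_on_add: "strict_mono_on A (\<lambda>x::nat. x + k)"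
  by (simp add: strict_mono_on_def)

text \<open>The list is cut before its maximum \<open>n\<close>. Avoidance puts the entries before
  \<open>n\<close> below those after it, so this is a direct sum; \<open>m\<close> is the size of
  the last summand, which starts with \<open>n\<close>.\<close>

lemma card_perm_lists:
  assumes "n \<ge> 1"
  shows "card (perm_lists n) = (\<Sum>m\<in>{1..n}. card (heads m) * card (perm_lists (n - m)))"
proof -
  define f where "f = (\<lambda>(m, vs, us). us @ n # map (\<lambda>x. x + (n - m)) vs)"
  have f_iff: "f (m, vs, us) \<in> perm_lists n \<longleftrightarrow> vs \<in> heads m \<and> us \<in> perm_lists (n - m)"
    if m: "m \<in> {1..n}" and sets: "set us = {1..n - m}" "set vs = {1..<m}" for m vs us
  proof -
    let ?w = "map (\<lambda>x. x + (n - m)) vs"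
    have w: "set ?w = {n - m + 1..<n}"
    proof -
      have "set ?w = (\<lambda>x. x + (n - m)) ` {1..<m}"
        using sets by simp
      also have "\<dots> = {n - m + 1..<n}"
        unfolding image_add_atLeastLessThan' using m by auto
      finally show ?thesis .
    qed
    have "set (us @ n # ?w) = {1..n}"
      unfolding set_append list.set(2) w sets(1) using m by auto
    moreover have "avoids231 (us @ n # ?w) \<longleftrightarrow> avoids231 us \<and> avoids231 vs"
      proof -
      have "\<forall>y\<in>set (us @ ?w). y < n" "\<forall>u\<in>set us. \<forall>v\<in>set ?w. u \<le> v"
        unfolding set_append w sets(1) using m by auto
      then show ?thesis
        using avoids231_max[of us ?w n] avoids231_map[of vs "\<lambda>x. x + (n - m)", OF strict_mono_on_add]
        by simp
    qed
    moreover have "shallow_list (us @ n # ?w) \<longleftrightarrow> shallow_list us \<and> shallow_list (m # vs)"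
    proof -
      have eq: "n # ?w = map (\<lambda>x. x + (n - m)) (m # vs)"
        using m by simp
      have sh: "shallow_list (n # ?w) \<longleftrightarrow> shallow_list (m # vs)"
        unfolding eq by (rule shallow_list_map[OF strict_mono_on_add])
      show ?thesis
      \<comment> \<open>The splitting lemma needs distinct entries; without them both sides are
        false.\<close>
      proof (cases "distinct (n # ?w)")
        case True
        moreover have "\<forall>u\<in>set us. \<forall>v\<in>set (n # ?w). u < v"
          unfolding list.set(2) w sets(1) using m by auto
        ultimately show ?thesis
          using shallow_list_append[of us "n # ?w"] sh by blast
      next
        case False
        then have "\<not> shallow_list (us @ n # ?w)" "\<not> shallow_list (n # ?w)"
          using shallow_list_distinct by fastforce+
        then show ?thesis using sh by blast
      qed
    qed
    ultimately show ?thesis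
      using sets by (auto simp: f_def perm_lists_def heads_def)
  qed
  have "bij_betw f (SIGMA m:{1..n}. heads m \<times> perm_lists (n - m)) (perm_lists n)"
  proof (rule bij_betw_imageI)
    show "inj_on f (SIGMA m:{1..n}. heads m \<times> perm_lists (n - m))"
    proof (rule inj_onI)
      fix x y
      assume *: "x \<in> (SIGMA m:{1..n}. heads m \<times> perm_lists (n - m))"
        "y \<in> (SIGMA m:{1..n}. heads m \<times> perm_lists (n - m))" "f x = f y"
      obtain m vs us m' vs' us' where xy: "x = (m, vs, us)" "y = (m', vs', us')"
        by (metis prod.collapse)
      have m: "m \<in> {1..n}" "m' \<in> {1..n}" and us: "us \<in> perm_lists (n - m)" "us' \<in> perm_lists (n - m')"
        and vs: "vs \<in> heads m" "vs' \<in> heads m'" and eq: "f (m, vs, us) = f (m', vs', us')"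
        using * xy by auto
      \<comment> \<open>The maximum \<open>n\<close> occurs only once, so the cut is unique, and the
        values in \<open>us\<close> then determine \<open>m\<close>.\<close>
      have "n \<notin> set us" "n \<notin> set (map (\<lambda>x. x + (n - m)) vs)"
        using us vs m by (auto simp: perm_lists_def heads_def)
      then have eqs: "us = us'" "map (\<lambda>x. x + (n - m)) vs = map (\<lambda>x. x + (n - m')) vs'"
        using eq by (simp_all add: f_def append_Cons_eq_iff)
      then have "{1..n - m} = {1..n - m'}"
        using us by (auto simp: perm_lists_def)
      then have "m = m'"
        using m by (metis atLeastAtMost_iff card_atLeastAtMost diff_Suc_1 diff_diff_cancel)
      moreover from this eqs have "vs = vs'"
        by (simp add: inj_map_eq_map inj_on_def)
      ultimately show "x = y"
        using eqs xy by blast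
    qed
    show "f ` (SIGMA m:{1..n}. heads m \<times> perm_lists (n - m)) = perm_lists n"
    proof
      show "f ` (SIGMA m:{1..n}. heads m \<times> perm_lists (n - m)) \<subseteq> perm_lists n"
      proof clarify
        fix m vs us
        assume m: "m \<in> {1..n}" and mem: "vs \<in> heads m" "us \<in> perm_lists (n - m)"
        then have "set us = {1..n - m}" "set vs = {1..<m}"
          by (simp_all add: perm_lists_def heads_def)
        from f_iff[OF m this] mem show "f (m, vs, us) \<in> perm_lists n" by blast
      qed
      show "perm_lists n \<subseteq> f ` (SIGMA m:{1..n}. heads m \<times> perm_lists (n - m))"
      proof
        fix xs assume xs: "xs \<in> perm_lists n"
        then have set: "set xs = {1..n}" and av: "avoids231 xs" and dist: "distinct xs"
          by (auto simp: perm_lists_def shallow_list_distinct)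
        have "n \<in> set xs"
          using set assms by simp
        then obtain us w where xs_eq: "xs = us @ n # w"
          by (meson split_list)
        have union: "set us \<union> set w = {1..<n}"
        proof (rule set_eqI)
          fix y
          have "y \<in> set us \<or> y = n \<or> y \<in> set w \<longleftrightarrow> 1 \<le> y \<and> y \<le> n"
            using set xs_eq by (metis Un_iff atLeastAtMost_iff list.set(2) insert_iff set_append)
          then show "y \<in> set us \<union> set w \<longleftrightarrow> y \<in> {1..<n}"
            using dist xs_eq by (cases "y = n") auto
        qed
        have below: "\<forall>y\<in>set (us @ w). y < n"
          using union by (auto simp: set_eq_iff)
        have less: "\<forall>u\<in>set us. \<forall>v\<in>set w. u < v"
          using av dist avoids231_max[OF below] xs_eq by (auto simp: le_less)
        define m where "m = n - card (set us)"
        note parts = split_interval[OF union less assms]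
        have m: "m \<in> {1..n}" "n - m = card (set us)"
          using parts(3) assms by (auto simp: m_def)
        have us: "set us = {1..<1 + (n - m)}" and w: "set w = {1 + (n - m)..<n}"
          unfolding m(2) by (rule parts)+
        define vs where "vs = map (\<lambda>x. x - (n - m)) w"
        have w_eq: "map (\<lambda>x. x + (n - m)) vs = w"
          unfolding vs_def using w by (intro map_add_minus) auto
        have "set us = {1..n - m}"
          by (simp only: us plus_1_eq_Suc atLeastLessThanSuc_atLeastAtMost)
        moreover have "set vs = {1..<m}"
        proof -
          have "set vs = (\<lambda>x. x - (n - m)) ` {1 + (n - m)..<m + (n - m)}"
            using w m(1) by (simp add: vs_def)
          also have "\<dots> = (\<lambda>x. x - (n - m)) ` (\<lambda>x. x + (n - m)) ` {1..<m}"
            by (simp only: image_add_atLeastLessThan')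
          finally show ?thesis
            by (simp only: image_image add_diff_cancel_right' image_ident)
        qed
        moreover have "f (m, vs, us) = xs"
          using w_eq xs_eq by (simp add: f_def)
        ultimately have "vs \<in> heads m" "us \<in> perm_lists (n - m)" "xs = f (m, vs, us)"
          using f_iff[OF m(1)] xs by auto
        then show "xs \<in> f ` (SIGMA m:{1..n}. heads m \<times> perm_lists (n - m))"
          using m(1) by blast
      qed
    qed
  qed
  then have "card (perm_lists n) = card (SIGMA m:{1..n}. heads m \<times> perm_lists (n - m))"
    by (rule bij_betw_same_card[symmetric])
  also have "\<dots> = (\<Sum>m\<in>{1..n}. card (heads m) * card (perm_lists (n - m)))"
    by (simp add: card_SigmaI finite_heads finite_perm_lists card_cartesian_product)
  finally show ?thesis .
qed

text \<open>The cut is made before \<open>n - 1\<close>, the largest entry after the leading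
  \<open>n\<close>. The entries \<open>us\<close> before it lie below those after it and decouple,
  with \<open>n\<close> as the leading maximum of both parts. For the first part \<open>n\<close> is
  relabelled as \<open>e\<close>; the second part is shifted down by \<open>e - 1\<close>.\<close>

lemma card_heads:
  assumes "n \<ge> 2"
  shows "card (heads n) = (\<Sum>e\<in>{1..<n}. card (heads e) * card (tails (n - 1 - e)))"
proof -
  define f where "f = (\<lambda>(e, us, vs). us @ (n - 1) # map (\<lambda>x. x + (e - 1)) vs)"
  have f_iff: "f (e, us, vs) \<in> heads n \<longleftrightarrow> us \<in> heads e \<and> vs \<in> tails (n - 1 - e)"
    if e: "e \<in> {1..<n}" and sets: "set us = {1..<e}" "set vs = {1..n - 1 - e}" for e us vs
  proof -
    let ?w = "map (\<lambda>x. x + (e - 1)) vs"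
    have w: "set ?w = {e..<n - 1}"
    proof -
      have "set ?w = (\<lambda>x. x + (e - 1)) ` {1..<n - e}"
        using e sets by (auto intro!: image_cong)
      also have "\<dots> = {e..<n - 1}"
        unfolding image_add_atLeastLessThan' using e by auto
      finally show ?thesis .
    qed
    have "set (us @ (n - 1) # ?w) = {1..<n}"
      unfolding set_append list.set(2) w sets(1) using e by auto
    moreover have "avoids231 (us @ (n - 1) # ?w) \<longleftrightarrow> avoids231 us \<and> avoids231 vs"
    proof -
      have "\<forall>y\<in>set (us @ ?w). y < n - 1" "\<forall>u\<in>set us. \<forall>v\<in>set ?w. u \<le> v"
        unfolding set_append w sets(1) using e by auto
      then show ?thesis
        using avoids231_max[of us ?w "n - 1"] avoids231_map[of vs "\<lambda>x. x + (e - 1)", OF strict_mono_on_add]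
        by simp
    qed
    moreover have "shallow_list (n # us @ (n - 1) # ?w) \<longleftrightarrow>
        shallow_list (e # us) \<and> shallow_list ((n - 1 - e + 2) # (n - 1 - e + 1) # vs)"
    proof -
      have eq: "n # (n - 1) # ?w = map (\<lambda>x. x + (e - 1)) ((n - 1 - e + 2) # (n - 1 - e + 1) # vs)"
        using e by auto
      have sh: "shallow_list (n # (n - 1) # ?w) \<longleftrightarrow>
          shallow_list ((n - 1 - e + 2) # (n - 1 - e + 1) # vs)"
        unfolding eq by (rule shallow_list_map[OF strict_mono_on_add])
      have sh': "shallow_list (e # us) \<longleftrightarrow> shallow_list (n # us)"
        using sets e by (intro shallow_list_Cons_max_cong) auto
      show ?thesis
      proof (cases "distinct (n # (n - 1) # ?w)")
        case True
        moreover have "\<forall>u\<in>set us. u < n" "\<forall>u\<in>set us. \<forall>z\<in>set ((n - 1) # ?w). u < z"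
          unfolding list.set(2) w sets(1) using e by auto
        ultimately show ?thesis
          using shallow_list_Cons_append[of us n "(n - 1) # ?w"] sh sh' by blast
      next
        case False
        then have "\<not> shallow_list (n # us @ (n - 1) # ?w)" "\<not> shallow_list (n # (n - 1) # ?w)"
          using shallow_list_distinct by fastforce+
        then show ?thesis using sh by blast
      qed
    qed
    ultimately show ?thesis
      using sets by (auto simp: f_def tails_def heads_def)
  qed
  have "bij_betw f (SIGMA e:{1..<n}. heads e \<times> tails (n - 1 - e)) (heads n)"
  proof (rule bij_betw_imageI)
    show "inj_on f (SIGMA e:{1..<n}. heads e \<times> tails (n - 1 - e))"
    proof (rule inj_onI)
      fix x y
      assume *: "x \<in> (SIGMA e:{1..<n}. heads e \<times> tails (n - 1 - e))"
        "y \<in> (SIGMA e:{1..<n}. heads e \<times> tails (n - 1 - e))" "f x = f y"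
      obtain e us vs e' us' vs' where xy: "x = (e, us, vs)" "y = (e', us', vs')"
        by (metis prod.collapse)
      have e: "e \<in> {1..<n}" "e' \<in> {1..<n}" and us: "us \<in> heads e" "us' \<in> heads e'"
        and vs: "vs \<in> tails (n - 1 - e)" "vs' \<in> tails (n - 1 - e')"
        and eq: "f (e, us, vs) = f (e', us', vs')"
        using * xy by auto
      have "n - 1 \<notin> set us" "n - 1 \<notin> set (map (\<lambda>x. x + (e - 1)) vs)"
        using us vs e by (auto simp: tails_def heads_def)
      then have eqs: "us = us'" "map (\<lambda>x. x + (e - 1)) vs = map (\<lambda>x. x + (e' - 1)) vs'"
        using eq by (simp_all add: f_def append_Cons_eq_iff)
      then have "{1..<e} = {1..<e'}"
        using us by (auto simp: heads_def)
      then have "card {1..<e} = card {1..<e'}"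
        by simp
      then have "e = e'"
        using e by auto
      moreover from this eqs have "vs = vs'"
        by (simp add: inj_map_eq_map inj_on_def)
      ultimately show "x = y"
        using eqs xy by blast
    qed
    show "f ` (SIGMA e:{1..<n}. heads e \<times> tails (n - 1 - e)) = heads n"
    proof
      show "f ` (SIGMA e:{1..<n}. heads e \<times> tails (n - 1 - e)) \<subseteq> heads n"
      proof clarify
        fix e us vs
        assume e: "e \<in> {1..<n}" and mem: "us \<in> heads e" "vs \<in> tails (n - 1 - e)"
        then have "set us = {1..<e}" "set vs = {1..n - 1 - e}"
          by (simp_all add: tails_def heads_def)
        from f_iff[OF e this] mem show "f (e, us, vs) \<in> heads n" by blast
      qed
      show "heads n \<subseteq> f ` (SIGMA e:{1..<n}. heads e \<times> tails (n - 1 - e))"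
      proof
        fix xs assume xs: "xs \<in> heads n"
        then have set: "set xs = {1..<n}" and av: "avoids231 xs" and sh: "shallow_list (n # xs)"
          by (auto simp: heads_def)
        have dist: "distinct xs"
          using shallow_list_distinct[OF sh] by simp
        have "n - 1 \<in> set xs"
          using set assms by simp
        then obtain us w where xs_eq: "xs = us @ (n - 1) # w"
          by (meson split_list)
        have union: "set us \<union> set w = {1..<n - 1}"
        proof (rule set_eqI)
          fix y
          have "y \<in> set us \<or> y = n - 1 \<or> y \<in> set w \<longleftrightarrow> 1 \<le> y \<and> y < n"
            using set xs_eq by (metis Un_iff atLeastLessThan_iff list.set(2) insert_iff set_append)
          then show "y \<in> set us \<union> set w \<longleftrightarrow> y \<in> {1..<n - 1}"
            using dist xs_eq by (cases "y = n - 1") auto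
        qed
        have below: "\<forall>y\<in>set (us @ w). y < n - 1"
          using union by (auto simp: set_eq_iff)
        have less: "\<forall>u\<in>set us. \<forall>v\<in>set w. u < v"
          using av dist avoids231_max[OF below] xs_eq by (auto simp: le_less)
        define e where "e = 1 + card (set us)"
        have "1 \<le> n - 1" using assms by simp
        note parts = split_interval[OF union less this]
        have e: "e \<in> {1..<n}" "e - 1 = card (set us)"
          using parts(3) assms by (auto simp: e_def)
        have w: "set w = {1 + (e - 1)..<n - 1}"
          unfolding e(2) by (rule parts)
        define vs where "vs = map (\<lambda>x. x - (e - 1)) w"
        have w_eq: "map (\<lambda>x. x + (e - 1)) vs = w"
          unfolding vs_def using w by (intro map_add_minus) auto
        have "set us = {1..<e}"
          unfolding e_def by (rule parts)
        moreover have "set vs = {1..n - 1 - e}"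
        proof -
          have "set vs = (\<lambda>x. x - (e - 1)) ` {1 + (e - 1)..<(n - e) + (e - 1)}"
          proof -
            have "(n - e) + (e - 1) = n - 1" using e(1) by auto
            then show ?thesis using w by (simp only: vs_def set_map)
          qed
          also have "\<dots> = (\<lambda>x. x - (e - 1)) ` (\<lambda>x. x + (e - 1)) ` {1..<n - e}"
            by (simp only: image_add_atLeastLessThan')
          finally have "set vs = {1..<n - e}"
            by (simp only: image_image add_diff_cancel_right' image_ident)
          moreover have "n - e = Suc (n - 1 - e)"
            using e(1) unfolding atLeastLessThan_iff by linarith
          ultimately show ?thesis
            by (simp only: atLeastLessThanSuc_atLeastAtMost)
        qed
        moreover have "f (e, us, vs) = xs"
          using w_eq xs_eq by (simp add: f_def)
        ultimately have "us \<in> heads e" "vs \<in> tails (n - 1 - e)" "xs = f (e, us, vs)"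
          using f_iff[OF e(1)] xs by auto
        then show "xs \<in> f ` (SIGMA e:{1..<n}. heads e \<times> tails (n - 1 - e))"
          using e(1) by blast
      qed
    qed
  qed
  then have "card (heads n) = card (SIGMA e:{1..<n}. heads e \<times> tails (n - 1 - e))"
    by (rule bij_betw_same_card[symmetric])
  also have "\<dots> = (\<Sum>e\<in>{1..<n}. card (heads e) * card (tails (n - 1 - e)))"
    by (simp add: card_SigmaI finite_heads finite_tails card_cartesian_product)
  finally show ?thesis .
qed

section \<open>Generating functions\<close>

unbundle fps_syntax

lemma card_perm_lists_0: "card (perm_lists 0) = 1"
proof -
  have "perm_lists 0 = {[]}"
    by (auto simp: perm_lists_def shallow_list.Nil)
  then show ?thesis by simp
qed

lemma card_heads_1: "card (heads 1) = 1"
proof -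
  have "heads 1 = {[]}"
    by (auto simp: heads_def)
  then show ?thesis by simp
qed

lemma fps_perm_lists:
  "Abs_fps (\<lambda>n. of_nat (card (perm_lists n)) :: rat) =
    (1 - 3 * fps_X + 2 * fps_X ^ 2 - fps_X ^ 3 - fps_X ^ 4 - fps_X ^ 5) /
    (1 - 4 * fps_X + 4 * fps_X ^ 2 - 2 * fps_X ^ 3 - fps_X ^ 4 - fps_X ^ 5)"
proof -
  let ?X = "fps_X :: rat fps"
  define T where "T = Abs_fps (\<lambda>n. of_nat (card (perm_lists n)) :: rat)"
  \<comment> \<open>\<open>heads 0\<close> also contains the empty list, but no permutation starting
    with its maximum has size 0; hence the constant coefficient is set to 0.\<close>
  define A where "A = Abs_fps (\<lambda>n. if n = 0 then 0 else of_nat (card (heads n)) :: rat)"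
  define V where "V = Abs_fps (\<lambda>n. of_nat (card (tails n)) :: rat)"
  have T: "T = 1 + A * T"
  proof (rule fps_ext)
    fix n :: nat
    show "T $ n = (1 + A * T) $ n"
    proof (cases "n = 0")
      case True
      then show ?thesis by (simp add: T_def A_def card_perm_lists_0)
    next
      case False
      have "(A * T) $ n = (\<Sum>i=0..n. A $ i * T $ (n - i))"
        by (simp add: fps_mult_nth)
      also have "\<dots> = (\<Sum>i=1..n. A $ i * T $ (n - i))"
        by (simp add: sum.atLeast_Suc_atMost A_def)
      also have "\<dots> = (\<Sum>i=1..n. of_nat (card (heads i) * card (perm_lists (n - i))))"
        by (intro sum.cong) (auto simp: A_def T_def)
      also have "\<dots> = T $ n"
        using card_perm_lists[of n] False by (simp add: T_def)
      finally show ?thesis using False by simp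
    qed
  qed
  have A: "A = ?X + ?X * (A * V)"
  proof (rule fps_ext)
    fix n :: nat
    consider "n = 0" | "n = 1" | "n \<ge> 2" by linarith
    then show "A $ n = (?X + ?X * (A * V)) $ n"
    proof cases
      case 1
      then show ?thesis by (simp add: A_def)
    next
      case 2
      then show ?thesis using card_heads_1 by (simp add: A_def)
    next
      case 3
      have "(?X * (A * V)) $ n = (\<Sum>i=0..n - 1. A $ i * V $ (n - 1 - i))"
        using 3 by (simp add: fps_mult_nth[of A V])
      also have "\<dots> = (\<Sum>i=1..n - 1. A $ i * V $ (n - 1 - i))"
        by (simp add: sum.atLeast_Suc_atMost A_def)
      also have "\<dots> = (\<Sum>i\<in>{1..<n}. of_nat (card (heads i) * card (tails (n - 1 - i))))"
        using 3 by (intro sum.cong) (auto simp: A_def V_def)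
      also have "\<dots> = A $ n"
        using card_heads[of n] 3 by (simp add: A_def)
      finally show ?thesis using 3 by simp
    qed
  qed
  have V_nth: "V $ n = (if n = 0 then 1 else of_nat (n + (n - 2) + (n - 3)))" for n
    using card_tails[of n] by (simp add: V_def tails_0)
  \<comment> \<open>The series with coefficients \<open>l\<close> is \<open>X / (1 - X)^2\<close>,
    so the terms \<open>l\<close>, \<open>l - 2\<close>, \<open>l - 3\<close> contribute
    \<open>X\<close>, \<open>X^3\<close>, \<open>X^4\<close>, and the constant term 1 contributes
    \<open>(1 - X)^2\<close>.\<close>
  have V: "V * (1 - ?X) ^ 2 = 1 - ?X + ?X ^ 2 + ?X ^ 3 + ?X ^ 4"
  proof (rule fps_ext)
    fix n :: nat
    have eq: "V * (1 - ?X) ^ 2 = V - 2 * (?X * V) + ?X * (?X * V)"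
      by (simp add: power2_eq_square algebra_simps)
    \<comment> \<open>The coefficients of \<open>V\<close> are \<open>3 * n - 5\<close> from
      \<open>n = 3\<close> on, so second differences vanish from \<open>n = 5\<close> on; the
      earlier ones are computed singly.\<close>
    consider "n = 0" | "n = 1" | "n = 2" | "n = 3" | "n = 4" | k where "n = k + 5"
    proof (cases "n \<ge> 5")
      case True
      then show ?thesis using that(6)[of "n - 5"] by simp
    next
      case False
      then have "n = 0 \<or> n = 1 \<or> n = 2 \<or> n = 3 \<or> n = 4" by linarith
      then show ?thesis using that by blast
    qed
    then show "(V * (1 - ?X) ^ 2) $ n = (1 - ?X + ?X ^ 2 + ?X ^ 3 + ?X ^ 4) $ n"
      unfolding eq
      by cases (simp_all add: V_nth fps_X_power_iff numeral_fps_const)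
  qed
  \<comment> \<open>Eliminating \<open>V\<close> from the equation for \<open>A\<close> gives
    \<open>A * N = X * (1 - X)^2\<close>. Eliminating \<open>A\<close> from the equation for
    \<open>T\<close> then produces \<open>D\<close>.\<close>
  define N where "N = (1 - ?X) ^ 2 - ?X * (1 - ?X + ?X ^ 2 + ?X ^ 3 + ?X ^ 4)"
  have "A * N = A * (1 - ?X) ^ 2 - ?X * (A * V) * (1 - ?X) ^ 2"
    unfolding N_def V[symmetric] by (simp add: algebra_simps)
  also have "\<dots> = (A - ?X * (A * V)) * (1 - ?X) ^ 2"
    by (simp add: algebra_simps)
  also have "A - ?X * (A * V) = ?X"
    using A by (metis add_diff_cancel_right')
  finally have AN: "A * N = ?X * (1 - ?X) ^ 2" .
  define D where "D = N - ?X * (1 - ?X) ^ 2"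
  have "T * D = N * (T - A * T)"
    unfolding D_def AN[symmetric] by (simp add: algebra_simps)
  also have "T - A * T = 1"
    using T by (metis add_diff_cancel_right')
  finally have TD: "T * D = N" by simp
  have N_eq: "N = 1 - 3 * ?X + 2 * ?X ^ 2 - ?X ^ 3 - ?X ^ 4 - ?X ^ 5"
    unfolding N_def by algebra
  have D_eq: "D = 1 - 4 * ?X + 4 * ?X ^ 2 - 2 * ?X ^ 3 - ?X ^ 4 - ?X ^ 5"
    unfolding D_def N_eq by algebra
  have "D $ 0 = 1"
    by (simp add: D_def N_def power2_eq_square)
  then have "D \<noteq> 0" by auto
  then have "N / D = T"
    by (metis TD nonzero_mult_div_cancel_right)
  then show ?thesis
    by (simp only: T_def N_eq D_eq)
qed

subsection \<open>Permutations in one-line notation\<close>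

text \<open>The index function becomes three positions. Each pair is compared both ways, as the
  definition ranges over ordered pairs of indices.\<close>

lemma contains_pattern_3:
  "contains_pattern n p [x, y, z] \<longleftrightarrow> (\<exists>i j k. 1 \<le> i \<and> i < j \<and> j < k \<and> k \<le> n \<and>
    (p i < p j \<longleftrightarrow> x < y) \<and> (p j < p i \<longleftrightarrow> y < x) \<and> (p i < p k \<longleftrightarrow> x < z) \<and>
    (p k < p i \<longleftrightarrow> z < x) \<and> (p j < p k \<longleftrightarrow> y < z) \<and> (p k < p j \<longleftrightarrow> z < y))"
    (is "?lhs \<longleftrightarrow> ?rhs")
proof
  assume L: ?lhs
  have "length [x, y, z] = 3" by simp
  from L[unfolded contains_pattern_def this] obtain idx :: "nat \<Rightarrow> nat" where idx:
    "\<And>a. a < 3 \<Longrightarrow> idx a \<in> {1..n}" "\<And>a b. a < b \<Longrightarrow> b < 3 \<Longrightarrow> idx a < idx b"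
    "\<And>a b. a < 3 \<Longrightarrow> b < 3 \<Longrightarrow> p (idx a) < p (idx b) \<longleftrightarrow> [x, y, z] ! a < [x, y, z] ! b"
    by blast
  show ?rhs
    using idx(1)[of 0] idx(1)[of 2] idx(2)[of 0 1] idx(2)[of 1 2] idx(3)[of 0 1] idx(3)[of 1 0]
      idx(3)[of 0 2] idx(3)[of 2 0] idx(3)[of 1 2] idx(3)[of 2 1]
    by (intro exI[of _ "idx 0"] exI[of _ "idx 1"] exI[of _ "idx 2"]) simp
next
  assume ?rhs
  then obtain i j k where ijk: "1 \<le> i" "i < j" "j < k" "k \<le> n"
    and rel: "p i < p j \<longleftrightarrow> x < y" "p j < p i \<longleftrightarrow> y < x" "p i < p k \<longleftrightarrow> x < z"
      "p k < p i \<longleftrightarrow> z < x" "p j < p k \<longleftrightarrow> y < z" "p k < p j \<longleftrightarrow> z < y"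
    by blast
  have less3: "a = 0 \<or> a = 1 \<or> a = 2" if "a < length [x, y, z]" for a
    using that by auto
  show ?lhs
    unfolding contains_pattern_def
  proof (intro exI[of _ "\<lambda>a. [i, j, k] ! a"] conjI allI impI)
    fix a assume "a < length [x, y, z]"
    from less3[OF this] show "[i, j, k] ! a \<in> {1..n}"
      using ijk by auto
  next
    fix a b :: nat assume ab: "a < b \<and> b < length [x, y, z]"
    then have "a < length [x, y, z]" "b < length [x, y, z]" by simp_all
    from this[THEN less3] show "[i, j, k] ! a < [i, j, k] ! b"
      using ijk ab by auto
  next
    fix a b assume "a < length [x, y, z]" "b < length [x, y, z]"
    from this[THEN less3] show "p ([i, j, k] ! a) < p ([i, j, k] ! b) \<longleftrightarrow> [x, y, z] ! a < [x, y, z] ! b"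
      by (elim disjE) (simp_all add: rel)
  qed
qed

lemma avoids_231:
  "avoids n p [2, 3, 1] \<longleftrightarrow> (\<nexists>i j k. 1 \<le> i \<and> i < j \<and> j < k \<and> k \<le> n \<and> p k < p i \<and> p i < p j)"
proof -
  have "contains_pattern n p [2, 3, 1] \<longleftrightarrow>
      (\<exists>i j k. 1 \<le> i \<and> i < j \<and> j < k \<and> k \<le> n \<and> p k < p i \<and> p i < p j)"
    unfolding contains_pattern_3 by (intro arg_cong[of _ _ Ex] ext) auto
  then show ?thesis
    by (simp add: avoids_def)
qed

lemma avoids_312:
  "avoids n p [3, 1, 2] \<longleftrightarrow> (\<nexists>i j k. 1 \<le> i \<and> i < j \<and> j < k \<and> k \<le> n \<and> p j < p k \<and> p k < p i)"
proof -
  have "contains_pattern n p [3, 1, 2] \<longleftrightarrow>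
      (\<exists>i j k. 1 \<le> i \<and> i < j \<and> j < k \<and> k \<le> n \<and> p j < p k \<and> p k < p i)"
    unfolding contains_pattern_3 by (intro arg_cong[of _ _ Ex] ext) auto
  then show ?thesis
    by (simp add: avoids_def)
qed

lemma avoids231_nth:
  "avoids231 xs \<longleftrightarrow> (\<nexists>i j k. i < j \<and> j < k \<and> k < length xs \<and> xs ! k < xs ! i \<and> xs ! i < xs ! j)"
proof (induction xs)
  case (Cons x xs)
  show ?case (is "_ \<longleftrightarrow> ?R")
  proof
    assume L: "avoids231 (x # xs)"
    show ?R
    proof clarify
      fix i j k
      assume *: "i < j" "j < k" "k < length (x # xs)"
        "(x # xs) ! k < (x # xs) ! i" "(x # xs) ! i < (x # xs) ! j"
      obtain j' k' where jk: "j = Suc j'" "k = Suc k'"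
        using *(1,2) by (cases j; cases k) auto
      show False
      proof (cases i)
        case 0
        have "\<not> (xs ! k' < x \<and> x < xs ! j')"
          using L * jk by (simp add: sorted_wrt_iff_nth_less)
        then show ?thesis
          using * jk 0 by simp
      next
        case (Suc i')
        then have "i' < j' \<and> j' < k' \<and> k' < length xs \<and> xs ! k' < xs ! i' \<and> xs ! i' < xs ! j'"
          using * jk by simp
        moreover have "avoids231 xs"
          using L by simp
        ultimately show ?thesis
          unfolding Cons.IH by blast
      qed
    qed
  next
    assume R: ?R
    have "sorted_wrt (\<lambda>y z. \<not> (z < x \<and> x < y)) xs"
      unfolding sorted_wrt_iff_nth_less
    proof (intro allI impI)
      fix j k assume "j < k" "k < length xs"
      then have "0 < Suc j \<and> Suc j < Suc k \<and> Suc k < length (x # xs)"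
        by simp
      then have "\<not> ((x # xs) ! Suc k < (x # xs) ! 0 \<and> (x # xs) ! 0 < (x # xs) ! Suc j)"
        using R by blast
      then show "\<not> (xs ! k < x \<and> x < xs ! j)"
        by simp
    qed
    moreover have "avoids231 xs"
      unfolding Cons.IH
    proof clarify
      fix i j k
      assume "i < j" "j < k" "k < length xs" and *: "xs ! k < xs ! i" "xs ! i < xs ! j"
      then have "Suc i < Suc j \<and> Suc j < Suc k \<and> Suc k < length (x # xs)"
        by simp
      then have "\<not> ((x # xs) ! Suc k < (x # xs) ! Suc i \<and> (x # xs) ! Suc i < (x # xs) ! Suc j)"
        using R by blast
      then show False
        using * by simp
    qed
    ultimately show "avoids231 (x # xs)" by simp
  qed
qed simp

definition one_line :: "nat \<Rightarrow> (nat \<Rightarrow> nat) \<Rightarrow> nat list" where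
  "one_line n p = map p [1..<Suc n]"

lemma length_one_line [simp]: "length (one_line n p) = n"
  by (simp add: one_line_def)

lemma nth_one_line: "i < n \<Longrightarrow> one_line n p ! i = p (Suc i)"
  by (simp add: one_line_def del: upt_Suc)

lemma set_one_line: "set (one_line n p) = p ` {1..n}"
  by (simp add: one_line_def atLeastLessThanSuc_atLeastAtMost del: upt_Suc)

lemma avoids_iff_avoids231: "avoids n p [2, 3, 1] \<longleftrightarrow> avoids231 (one_line n p)"
proof -
  have "(\<exists>i j k. 1 \<le> i \<and> i < j \<and> j < k \<and> k \<le> n \<and> p k < p i \<and> p i < p j) \<longleftrightarrow>
      (\<exists>i j k. i < j \<and> j < k \<and> k < n \<and> p (Suc k) < p (Suc i) \<and> p (Suc i) < p (Suc j))"
    (is "?L \<longleftrightarrow> ?R")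
  proof
    assume ?L
    then obtain i j k where "1 \<le> i" "i < j" "j < k" "k \<le> n" "p k < p i" "p i < p j"
      by blast
    then show ?R
      by (intro exI[of _ "i - 1"] exI[of _ "j - 1"] exI[of _ "k - 1"]) auto
  next
    assume ?R
    then obtain i j k where "i < j" "j < k" "k < n" "p (Suc k) < p (Suc i)" "p (Suc i) < p (Suc j)"
      by blast
    then show ?L
      by (intro exI[of _ "Suc i"] exI[of _ "Suc j"] exI[of _ "Suc k"]) auto
  qed
  also have "?R \<longleftrightarrow> (\<exists>i j k. i < j \<and> j < k \<and> k < length (one_line n p) \<and>
      one_line n p ! k < one_line n p ! i \<and> one_line n p ! i < one_line n p ! j)"
    by (intro arg_cong[of _ _ Ex] ext) (auto simp: nth_one_line)
  finally show ?thesis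
    unfolding avoids_231 avoids231_nth by blast
qed

lemma one_line_inj:
  assumes "p permutes {1..n}" "q permutes {1..n}" "one_line n p = one_line n q"
  shows "p = q"
proof
  fix i
  show "p i = q i"
  proof (cases "i \<in> {1..n}")
    case True
    then show ?thesis
      using nth_one_line[of "i - 1" n p] nth_one_line[of "i - 1" n q] assms(3) by auto
  next
    case False
    then show ?thesis
      using assms(1,2) by (simp add: permutes_not_in)
  qed
qed

lemma one_line_surj:
  assumes "distinct xs" "set xs = {1..n}"
  obtains p where "p permutes {1..n}" "one_line n p = xs"
proof -
  have len: "length xs = n"
    using assms distinct_card[of xs] by simp
  define p where "p i = (if i \<in> {1..n} then xs ! (i - 1) else i)" for i
  have eq: "one_line n p = xs"
    by (rule nth_equalityI) (auto simp: len nth_one_line p_def)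
  then have "p ` {1..n} = {1..n}"
    using set_one_line assms(2) by metis
  then have "bij_betw p {1..n} {1..n}"
    by (metis bij_betw_imageI finite_atLeastAtMost finite_surj_inj order_refl)
  then have "p permutes {1..n}"
    by (rule bij_imp_permutes) (auto simp: p_def)
  then show ?thesis using that eq by blast
qed

section \<open>Inversions and cycles\<close>

fun list_inversions :: "'a::linorder list \<Rightarrow> nat" where
  "list_inversions [] = 0"
| "list_inversions (x # xs) = length (filter (\<lambda>y. y < x) xs) + list_inversions xs"

lemma list_inversions_insert:
  "list_inversions (us @ x # vs) = list_inversions (us @ vs) +
    length (filter (\<lambda>u. x < u) us) + length (filter (\<lambda>v. v < x) vs)"
  by (induction us) auto

lemma inversions_conv_list: "inversions n p = list_inversions (one_line n p)"
proof (induction n)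
  case 0
  then show ?case by (simp add: inversions_def one_line_def)
next
  case (Suc n)
  let ?S = "\<lambda>n. {(i, j). i \<in> {1..n} \<and> j \<in> {1..n} \<and> i < j \<and> p i > p j}"
  let ?I = "{i \<in> {1..n}. p (Suc n) < p i}"
  have "?S (Suc n) = ?S n \<union> (\<lambda>i. (i, Suc n)) ` ?I"
    by (auto simp: le_Suc_eq)
  moreover have "finite (?S n)"
    by (rule finite_subset[of _ "{1..n} \<times> {1..n}"]) auto
  moreover have "?S n \<inter> (\<lambda>i. (i, Suc n)) ` ?I = {}"
    by auto
  ultimately have "inversions (Suc n) p = inversions n p + card ?I"
    by (simp add: inversions_def card_Un_disjoint card_image inj_on_def)
  also have "card ?I = length (filter (\<lambda>u. p (Suc n) < u) (one_line n p))"
  proof -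
    have "length (filter (\<lambda>u. p (Suc n) < u) (one_line n p)) =
        card (set (filter (\<lambda>i. p (Suc n) < p i) [1..<Suc n]))"
      by (subst distinct_card) (simp_all add: one_line_def filter_map o_def del: upt_Suc)
    also have "set (filter (\<lambda>i. p (Suc n) < p i) [1..<Suc n]) = ?I"
      by auto
    finally show ?thesis by simp
  qed
  finally show ?case
    using Suc list_inversions_insert[of "one_line n p" "p (Suc n)" "[]"]
    by (simp add: one_line_def)
qed

lemma cycle_of_eq_orbit:
  assumes "p permutes {1..n}" "i \<in> {1..n}"
  shows "cycle_of n p i = orbit p i"
proof -
  have "permutation p"
    using assms(1) permutation_permutes by blast
  then have "orbit p i = {(p ^^ k) i | k. True}"
    by (rule orbit_altdef_permutation)
  then show ?thesis
    using permutes_orbit_subset[OF assms] by (auto simp: cycle_of_def)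
qed

lemma num_cycles_eq: "p permutes {1..n} \<Longrightarrow> num_cycles n p = card (orbit p ` {1..n})"
  unfolding num_cycles_def by (intro arg_cong[of _ _ card] image_cong) (auto simp: cycle_of_eq_orbit)

lemma orbit_eq_of_mem:
  assumes "permutation p" "y \<in> orbit p x"
  shows "orbit p y = orbit p x"
  using orbit_cyclic_eq3[OF cyclic_on_orbit'[OF assms(1)] assms(2)] .

lemma num_cycles_fixed_last:
  assumes "p permutes {1..n}"
  shows "num_cycles (Suc n) p = num_cycles n p + 1"
proof -
  have p: "p permutes {1..Suc n}"
    using assms by (rule permutes_subset) auto
  have "p (Suc n) = Suc n"
    using assms by (simp add: permutes_not_in)
  then have "orbit p (Suc n) = {Suc n}"
    by (simp add: orbit_eq_singleton_iff)
  then have "orbit p ` {1..Suc n} = insert {Suc n} (orbit p ` {1..n})"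
    by (simp add: atLeastAtMostSuc_conv)
  moreover have "{Suc n} \<notin> orbit p ` {1..n}"
    using permutes_orbit_subset[OF assms] by fastforce
  ultimately show ?thesis
    by (simp add: num_cycles_eq[OF assms] num_cycles_eq[OF p])
qed

text \<open>\<open>q\<close> bypasses \<open>n + 1\<close> by sending \<open>j\<close> directly to
  \<open>p (Suc n)\<close>. The cycle through \<open>n + 1\<close> also contains \<open>j\<close>,
  so it is shortened but does not vanish.\<close>

lemma num_cycles_remove_last:
  assumes p: "p permutes {1..Suc n}" and q: "q permutes {1..n}"
    and j: "p j = Suc n" "j \<in> {1..n}" "q j = p (Suc n)"
    and eq: "\<And>i. i \<in> {1..n} \<Longrightarrow> i \<noteq> j \<Longrightarrow> q i = p i"
  shows "num_cycles (Suc n) p = num_cycles n q"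
proof -
  have perm: "permutation p" "permutation q"
    using p q permutation_permutes by blast+
  have orbit: "orbit q i = orbit p i \<inter> {1..n}" if i: "i \<in> {1..n}" for i
  proof
    have sub: "orbit q i \<subseteq> {1..n}"
      using q i by (rule permutes_orbit_subset)
    \<comment> \<open>One step of \<open>q\<close> is one step of \<open>p\<close>, or two steps
      through \<open>n + 1\<close> when it starts at \<open>j\<close>.\<close>
    have step: "q y \<in> orbit p i" if "y \<in> {1..n}" "y \<in> orbit p i" for y
      using that j eq by (metis orbit.step)
    have "y \<in> orbit p i" if "y \<in> orbit q i" for y
      using that
    proof induction
      case base
      show ?case by (rule step[OF i permutation_self_in_orbit[OF perm(1)]])
    next
      case (step y)
      then show ?case using \<open>\<And>y. y \<in> {1..n} \<Longrightarrow> y \<in> orbit p i \<Longrightarrow> q y \<in> orbit p i\<close> sub by blast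
    qed
    then show "orbit q i \<subseteq> orbit p i \<inter> {1..n}"
      using sub by blast
    \<comment> \<open>The orbit under \<open>p\<close> may also visit \<open>n + 1\<close>, but only
      by way of \<open>j\<close>. The invariant records this, so that the next step lands at
      \<open>q j\<close>.\<close>
    have step': "p y \<in> orbit q i \<or> p y = Suc n \<and> j \<in> orbit q i"
      if "y \<in> orbit q i \<or> y = Suc n \<and> j \<in> orbit q i" for y
      using that
    proof
      assume y: "y \<in> orbit q i"
      show ?thesis
      proof (cases "y = j")
        case False
        then have "p y = q y" using eq y sub by fastforce
        then show ?thesis using y by (simp add: orbit.step)
      qed (use y j in simp)
    next
      assume "y = Suc n \<and> j \<in> orbit q i"
      then show ?thesis using j(3) by (metis orbit.step)
    qed
    have "y \<in> orbit q i \<or> y = Suc n \<and> j \<in> orbit q i" if "y \<in> orbit p i" for y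
      using that
    proof induction
      case base
      show ?case by (rule step') (use permutation_self_in_orbit[OF perm(2)] in blast)
    next
      case (step y)
      from step(2) show ?case by (rule step')
    qed
    then show "orbit p i \<inter> {1..n} \<subseteq> orbit q i"
      by fastforce
  qed
  have "p (Suc n) \<in> {1..n}"
    using j(2,3) permutes_in_image[OF q, of j] by simp
  moreover have "orbit p (Suc n) = orbit p (p (Suc n))"
    by (rule orbit_eq_of_mem[OF perm(1) orbit.base, symmetric])
  ultimately have "orbit p ` {1..Suc n} = orbit p ` {1..n}"
    by (auto simp: atLeastAtMostSuc_conv)
  \<comment> \<open>Distinct orbits of \<open>p\<close> are disjoint, and these all meet
    \<open>{1..n}\<close>, so restricting them to \<open>{1..n}\<close> identifies no two.\<close>
  moreover have "inj_on (\<lambda>C. C \<inter> {1..n}) (orbit p ` {1..n})"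
  proof (rule inj_onI)
    fix C C' assume *: "C \<in> orbit p ` {1..n}" "C' \<in> orbit p ` {1..n}" "C \<inter> {1..n} = C' \<inter> {1..n}"
    then obtain i where "i \<in> {1..n}" "C = orbit p i" by blast
    moreover obtain i' where "C' = orbit p i'" using * by blast
    moreover have "i \<in> C"
      using calculation permutation_self_in_orbit[OF perm(1)] by simp
    then have "i \<in> C'" using * \<open>i \<in> {1..n}\<close> by blast
    ultimately show "C = C'"
      using orbit_eq_of_mem[OF perm(1)] by simp
  qed
  moreover have "orbit q ` {1..n} = (\<lambda>C. C \<inter> {1..n}) ` orbit p ` {1..n}"
    unfolding image_image by (intro image_cong) (simp_all add: orbit)
  ultimately show ?thesis
    by (simp add: num_cycles_eq[OF p] num_cycles_eq[OF q] card_image)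
qed

subsection \<open>The defect\<close>

definition defect :: "nat \<Rightarrow> (nat \<Rightarrow> nat) \<Rightarrow> int" where
  "defect n p = displacement n p - int (inversions n p) - reflection_length n p"

lemma shallow_iff_defect: "shallow n p \<longleftrightarrow> defect n p = 0"
  by (auto simp: shallow_def defect_def)

lemma permutes_fixed_last:
  assumes "p permutes {1..Suc n}" "p (Suc n) = Suc n"
  shows "p permutes {1..n}"
proof (rule permutes_superset[OF assms(1)])
  fix x assume "x \<in> {1..Suc n} - {1..n}"
  then have "x = Suc n" by auto
  then show "p x = x" using assms(2) by simp
qed

text \<open>A final fixed point has displacement 0, lies in no inversion, and raises both the size
  and the number of cycles by one.\<close>

lemma defect_fixed_last:
  assumes "p permutes {1..n}"
  shows "defect (Suc n) p = defect n p"
proof -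
  have "p (Suc n) = Suc n"
    using assms by (simp add: permutes_not_in)
  moreover have "p i \<le> n" if "i \<in> {1..n}" for i
    using permutes_in_image[OF assms, of i] that by simp
  then have "filter (\<lambda>u. Suc n < u) (one_line n p) = []"
    using permutes_image[OF assms] by (fastforce simp: filter_empty_conv set_one_line)
  then have "list_inversions (one_line n p @ [Suc n]) = list_inversions (one_line n p)"
    using list_inversions_insert[of "one_line n p" "Suc n" "[]"] by simp
  ultimately show ?thesis
    using num_cycles_fixed_last[OF assms]
    by (simp add: defect_def displacement_def inversions_conv_list one_line_def reflection_length_def)
qed

text \<open>\<open>M\<close> brings \<open>length vs + 1\<close> inversions. Moving \<open>e\<close>
  to the end loses one for each smaller entry of \<open>vs\<close> and gains one for each larger
  entry; in total the smaller ones cancel and the larger ones count twice.\<close>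

lemma list_inversions_step:
  assumes "distinct (us @ e # vs)" "\<forall>u\<in>set (us @ e # vs). u < M"
  shows "list_inversions (us @ M # vs @ [e]) =
    list_inversions (us @ e # vs) + 1 + 2 * length (filter (\<lambda>v. e < v) vs)"
proof -
  have "filter (\<lambda>u. M < u) us = []" "filter (\<lambda>v. v < M) (vs @ [e]) = vs @ [e]"
    using assms(2) by (auto simp: filter_empty_conv dest: less_asym)
  then have "list_inversions (us @ M # vs @ [e]) = list_inversions (us @ vs @ [e]) + length vs + 1"
    by (simp add: list_inversions_insert)
  also have "list_inversions (us @ vs @ [e]) = list_inversions (us @ vs) +
      length (filter (\<lambda>u. e < u) us) + length (filter (\<lambda>v. e < v) vs)"
    using list_inversions_insert[of "us @ vs" e "[]"] by simp
  also have "length vs = length (filter (\<lambda>v. e < v) vs) + length (filter (\<lambda>v. v < e) vs)"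
  proof -
    have "filter (\<lambda>v. v < e) vs = filter (\<lambda>v. \<not> e < v) vs"
      using assms(1) by (intro filter_cong) (auto simp: not_less le_less)
    then show ?thesis
      using sum_length_filter_compl[of "\<lambda>v. e < v" vs] by simp
  qed
  finally show ?thesis
    by (simp add: list_inversions_insert)
qed

lemma defect_remove_last:
  assumes p: "p permutes {1..Suc n}" and j: "p j = Suc n" "j \<in> {1..n}"
  obtains q us e vs where "q permutes {1..n}" "one_line (Suc n) p = us @ Suc n # vs @ [e]"
    "one_line n q = us @ e # vs" "\<forall>u\<in>set (us @ e # vs). u < Suc n"
    "defect (Suc n) p = defect n q +
      2 * int (min (length (filter (\<lambda>u. e < u) us)) (length (filter (\<lambda>v. v < e) vs)))"
proof -
  define e where "e = p (Suc n)"
  define q where "q = p \<circ> transpose j (Suc n)"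
  define us where "us = map p [1..<j]"
  define vs where "vs = map p [Suc j..<Suc n]"
  have qN: "q permutes {1..Suc n}"
    unfolding q_def using j(2) by (intro permutes_compose[OF permutes_swap_id p]) auto
  have "q (Suc n) = Suc n"
    using j by (simp add: q_def)
  then have q: "q permutes {1..n}"
    by (intro permutes_fixed_last[OF qN])
  have q_j: "q j = e" and q_eq: "\<And>i. i \<in> {1..n} \<Longrightarrow> i \<noteq> j \<Longrightarrow> q i = p i"
    by (auto simp: q_def e_def transpose_def)
  have upt: "[1..<Suc n] = [1..<j] @ j # [Suc j..<Suc n]"
    using j(2) upt_add_eq_append[of 1 j "Suc n - j"] upt_conv_Cons[of j "Suc n"] by (simp del: upt_Suc)
  have lp: "one_line (Suc n) p = us @ Suc n # vs @ [e]"
    unfolding one_line_def us_def vs_def e_def upt_Suc[of 1 "Suc n"] using upt j(1) by simp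
  have lq: "one_line n q = us @ e # vs"
    unfolding one_line_def us_def vs_def upt using q_eq q_j j(2) by (auto simp del: upt_Suc)
  have set_q: "set (us @ e # vs) = {1..n}"
    using set_one_line[of n q] permutes_image[OF q] lq by simp
  have len: "length (us @ e # vs) = n"
    using length_one_line[of n q] lq by simp
  have dist: "distinct (us @ e # vs)"
    using set_q len card_distinct[of "us @ e # vs"] by simp
  have below: "\<forall>u\<in>set (us @ e # vs). u < Suc n"
    unfolding set_q by auto
  \<comment> \<open>These three counts express all changes: \<open>B + C = n - j\<close> counts
    \<open>vs\<close>, and \<open>A + B = n - e\<close> counts the values above
    \<open>e\<close>.\<close>
  define A where "A = length (filter (\<lambda>u. e < u) us)"
  define B where "B = length (filter (\<lambda>v. e < v) vs)"
  define C where "C = length (filter (\<lambda>v. v < e) vs)"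
  have e: "1 \<le> e" "e \<le> n"
    using set_q by auto
  have BC: "B + C = n - j"
  proof -
    have "filter (\<lambda>v. v < e) vs = filter (\<lambda>v. \<not> e < v) vs"
      using dist by (intro filter_cong) (auto simp: not_less le_less)
    then have "B + C = length vs"
      unfolding B_def C_def using sum_length_filter_compl[of "\<lambda>v. e < v" vs] by simp
    then show ?thesis by (simp add: vs_def del: upt_Suc)
  qed
  have AB: "A + B = n - e"
  proof -
    have "A + B = length (filter (\<lambda>u. e < u) (us @ e # vs))"
      by (simp add: A_def B_def)
    also have "\<dots> = card (set (filter (\<lambda>u. e < u) (us @ e # vs)))"
      using dist by (intro distinct_card[symmetric] distinct_filter)
    also have "set (filter (\<lambda>u. e < u) (us @ e # vs)) = {Suc e..n}"
      unfolding set_filter set_q using e by auto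
    finally show ?thesis by simp
  qed
  have inv: "inversions (Suc n) p = inversions n q + 1 + 2 * B"
    unfolding inversions_conv_list lp lq B_def by (rule list_inversions_step[OF dist below])
  have cyc: "num_cycles (Suc n) p = num_cycles n q"
    using num_cycles_remove_last[OF p q j] q_j q_eq by (simp add: e_def)
  have disp: "displacement (Suc n) p =
      displacement n q + (int (Suc n) - int j) + (int (Suc n) - int e) - \<bar>int e - int j\<bar>"
  proof -
    define R where "R = (\<Sum>i\<in>{1..n} - {j}. \<bar>int (p i) - int i\<bar>)"
    have "(\<Sum>i\<in>{1..n}. \<bar>int (p i) - int i\<bar>) = \<bar>int (p j) - int j\<bar> + R"
      unfolding R_def using j(2) by (intro sum.remove) auto
    moreover have "(\<Sum>i\<in>{1..n}. \<bar>int (q i) - int i\<bar>) = \<bar>int (q j) - int j\<bar> + (\<Sum>i\<in>{1..n} - {j}. \<bar>int (q i) - int i\<bar>)"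
      using j(2) by (intro sum.remove) auto
    moreover have "(\<Sum>i\<in>{1..n} - {j}. \<bar>int (q i) - int i\<bar>) = R"
      unfolding R_def using q_eq by (intro sum.cong) auto
    moreover have "displacement (Suc n) p = (\<Sum>i\<in>{1..n}. \<bar>int (p i) - int i\<bar>) + \<bar>int e - int (Suc n)\<bar>"
      by (simp add: displacement_def e_def)
    ultimately show ?thesis
      using j e by (simp add: displacement_def q_j)
  qed
  have "defect (Suc n) p = defect n q + 2 * int (min A C)"
  proof -
    have ints: "int B + int C = int n - int j" "int A + int B = int n - int e"
      using BC AB j(2) e by auto
    \<comment> \<open>By \<open>ints\<close>, \<open>e - j\<close> equals \<open>C - A\<close>, and
      \<open>A + C\<close> minus the distance of \<open>A\<close> and \<open>C\<close> is twice
      their minimum.\<close>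
    have "\<bar>int e - int j\<bar> = int A + int C - 2 * int (min A C)"
      using ints by (auto simp: min_def)
    then show ?thesis
      unfolding defect_def disp inv reflection_length_def cyc using ints by simp
  qed
  then show ?thesis
    using that[OF q lp lq below] by (simp add: A_def C_def)
qed

text \<open>Nonnegativity is the Diaconis-Graham inequality \<open>I + T \<le> D\<close>. Both
  claims are proved together: by nonnegativity the defect vanishes only if the smaller defect and
  the added minimum both do, and the minimum is 0 exactly under the last premise of
  \<open>step\<close>.\<close>

lemma defect_shallow_list:
  assumes "p permutes {1..n}"
  shows "defect n p \<ge> 0 \<and> (defect n p = 0 \<longleftrightarrow> shallow_list (one_line n p))"
  using assms
proof (induction n arbitrary: p)
  case 0
  then show ?case
    by (simp add: defect_def displacement_def inversions_conv_list one_line_def reflection_length_def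
        num_cycles_def shallow_list.Nil)
next
  case (Suc n)
  obtain j where j: "j \<in> {1..Suc n}" "p j = Suc n"
    using permutes_image[OF Suc.prems] by (metis atLeastAtMost_iff imageE le_add1 le_refl plus_1_eq_Suc)
  show ?case
  proof (cases "j = Suc n")
    case True
    then have p: "p permutes {1..n}"
      using j by (intro permutes_fixed_last[OF Suc.prems]) simp
    have "\<forall>u\<in>set (one_line n p). u < Suc n"
      unfolding set_one_line permutes_image[OF p] by auto
    then have "shallow_list (one_line n p @ [Suc n]) \<longleftrightarrow> shallow_list (one_line n p)"
      by (rule shallow_list_snoc_max)
    moreover have "one_line (Suc n) p = one_line n p @ [Suc n]"
      using True j by (simp add: one_line_def)
    ultimately show ?thesis
      using Suc.IH[OF p] defect_fixed_last[OF p] by simp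
  next
    case False
    then have "j \<in> {1..n}" using j by auto
    then obtain q us e vs where q: "q permutes {1..n}"
      and lp: "one_line (Suc n) p = us @ Suc n # vs @ [e]" and lq: "one_line n q = us @ e # vs"
      and below: "\<forall>u\<in>set (us @ e # vs). u < Suc n"
      and def: "defect (Suc n) p = defect n q +
        2 * int (min (length (filter (\<lambda>u. e < u) us)) (length (filter (\<lambda>v. v < e) vs)))"
      by (rule defect_remove_last[OF Suc.prems j(2)])
    have "distinct (us @ e # vs)"
      using lq set_one_line[of n q] permutes_image[OF q] length_one_line[of n q]
      by (metis card_atLeastAtMost card_distinct diff_Suc_1)
    then have "filter (\<lambda>u. e < u) us = [] \<longleftrightarrow> (\<forall>u\<in>set us. u < e)"
        "filter (\<lambda>v. v < e) vs = [] \<longleftrightarrow> (\<forall>v\<in>set vs. e < v)"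
      by (auto simp: filter_empty_conv not_less le_less)
    moreover define m where "m = min (length (filter (\<lambda>u. e < u) us)) (length (filter (\<lambda>v. v < e) vs))"
    then have "m = 0 \<longleftrightarrow> filter (\<lambda>u. e < u) us = [] \<or> filter (\<lambda>v. v < e) vs = []"
      by (metis length_0_conv linorder_le_cases min.absorb1 min.absorb2 le_zero_eq)
    ultimately have m: "m = 0 \<longleftrightarrow> (\<forall>u\<in>set us. u < e) \<or> (\<forall>v\<in>set vs. e < v)"
      by blast
    have def': "defect (Suc n) p = defect n q + 2 * int m"
      unfolding m_def by (rule def)
    have IH: "defect n q \<ge> 0" "defect n q = 0 \<longleftrightarrow> shallow_list (us @ e # vs)"
      using Suc.IH[OF q] lq by simp_all
    have "defect (Suc n) p \<ge> 0" "defect (Suc n) p = 0 \<longleftrightarrow> defect n q = 0 \<and> m = 0"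
      using def' IH(1) by auto
    then show ?thesis
      unfolding lp shallow_list_max[OF below] m IH(2) by blast
  qed
qed

lemma shallow_iff_shallow_list:
  "p permutes {1..n} \<Longrightarrow> shallow n p \<longleftrightarrow> shallow_list (one_line n p)"
  by (simp add: shallow_iff_defect defect_shallow_list)

section \<open>From lists back to permutations, and from 231 to 312\<close>

lemma shallow_avoiders_231: "shallow_avoiders [2, 3, 1] n = card (perm_lists n)"
proof -
  have "bij_betw (one_line n) {p. p permutes {1..n} \<and> shallow n p \<and> avoids n p [2, 3, 1]} (perm_lists n)"
  proof (rule bij_betw_imageI)
    show "inj_on (one_line n) {p. p permutes {1..n} \<and> shallow n p \<and> avoids n p [2, 3, 1]}"
      using one_line_inj by (blast intro: inj_onI)
    show "one_line n ` {p. p permutes {1..n} \<and> shallow n p \<and> avoids n p [2, 3, 1]} = perm_lists n"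
    proof
      show "one_line n ` {p. p permutes {1..n} \<and> shallow n p \<and> avoids n p [2, 3, 1]} \<subseteq> perm_lists n"
        by (auto simp: perm_lists_def set_one_line permutes_image shallow_iff_shallow_list avoids_iff_avoids231
            simp del: One_nat_def)
      show "perm_lists n \<subseteq> one_line n ` {p. p permutes {1..n} \<and> shallow n p \<and> avoids n p [2, 3, 1]}"
      proof
        fix xs assume xs: "xs \<in> perm_lists n"
        then obtain p where "p permutes {1..n}" "one_line n p = xs"
          using one_line_surj[of xs n] by (auto simp: perm_lists_def shallow_list_distinct)
        then show "xs \<in> one_line n ` {p. p permutes {1..n} \<and> shallow n p \<and> avoids n p [2, 3, 1]}"
          using xs by (auto simp: perm_lists_def shallow_iff_shallow_list avoids_iff_avoids231
            simp del: One_nat_def)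
      qed
    qed
  qed
  then show ?thesis
    unfolding shallow_avoiders_def by (rule bij_betw_same_card)
qed

text \<open>Reindexing by \<open>p\<close> preserves the displacement, an inversion at
  \<open>i < j\<close> becomes one at \<open>p j < p i\<close>, and a permutation and its inverse
  have the same orbits.\<close>

lemma shallow_inv:
  assumes "p permutes {1..n}"
  shows "shallow n (inv p) \<longleftrightarrow> shallow n p"
proof -
  note inv = permutes_inv[OF assms]
  note inverses [simp] = permutes_inverses[OF assms]
  have mem: "p i \<in> {1..n} \<longleftrightarrow> i \<in> {1..n}" "inv p i \<in> {1..n} \<longleftrightarrow> i \<in> {1..n}" for i
    using permutes_in_image[OF assms] permutes_in_image[OF inv] by simp_all
  have "displacement n (inv p) = (\<Sum>i\<in>{1..n}. \<bar>int (inv p (p i)) - int (p i)\<bar>)"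
    unfolding displacement_def using sum.permute[OF assms, of "\<lambda>i. \<bar>int (inv p i) - int i\<bar>"]
    by (simp add: o_def)
  then have "displacement n (inv p) = displacement n p"
    by (simp add: displacement_def abs_minus_commute)
  moreover have "inversions n (inv p) = inversions n p"
  proof -
    have "bij_betw (\<lambda>(i, j). (p j, p i))
        {(i, j). i \<in> {1..n} \<and> j \<in> {1..n} \<and> i < j \<and> p i > p j}
        {(i, j). i \<in> {1..n} \<and> j \<in> {1..n} \<and> i < j \<and> inv p i > inv p j}"
      by (rule bij_betw_byWitness[where f' = "\<lambda>(i, j). (inv p j, inv p i)"])
        (use mem in \<open>auto simp del: atLeastAtMost_iff\<close>)
    then show ?thesis
      unfolding inversions_def by (rule bij_betw_same_card[symmetric])
  qed
  moreover have "num_cycles n (inv p) = num_cycles n p"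
  proof -
    have "permutation p"
      using assms permutation_permutes by blast
    then show ?thesis
      by (simp add: num_cycles_eq[OF assms] num_cycles_eq[OF inv] orbit_inv_eq)
  qed
  ultimately show ?thesis
    by (simp add: shallow_def reflection_length_def)
qed

text \<open>Inversion exchanges positions and values, and 312 is the inverse of 231. The witnesses
  are the images of the given positions, listed in increasing order.\<close>

lemma avoids_inv:
  assumes "p permutes {1..n}"
  shows "avoids n (inv p) [3, 1, 2] \<longleftrightarrow> avoids n p [2, 3, 1]"
proof -
  note inv = permutes_inv[OF assms]
  note inverses [simp] = permutes_inverses[OF assms]
  have mem: "1 \<le> p i \<and> p i \<le> n \<longleftrightarrow> 1 \<le> i \<and> i \<le> n" "1 \<le> inv p i \<and> inv p i \<le> n \<longleftrightarrow> 1 \<le> i \<and> i \<le> n" for i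
    using permutes_in_image[OF assms, of i] permutes_in_image[OF inv, of i] by simp_all
  have "(\<exists>i j k. 1 \<le> i \<and> i < j \<and> j < k \<and> k \<le> n \<and> inv p j < inv p k \<and> inv p k < inv p i) \<longleftrightarrow>
      (\<exists>i j k. 1 \<le> i \<and> i < j \<and> j < k \<and> k \<le> n \<and> p k < p i \<and> p i < p j)" (is "?L \<longleftrightarrow> ?R")
  proof
    assume ?L
    then obtain i j k where "1 \<le> i" "i < j" "j < k" "k \<le> n" "inv p j < inv p k" "inv p k < inv p i"
      by blast
    then show ?R
      using mem(2)[of i] mem(2)[of j]
      by (intro exI[of _ "inv p j"] exI[of _ "inv p k"] exI[of _ "inv p i"]) auto
  next
    assume ?R
    then obtain i j k where "1 \<le> i" "i < j" "j < k" "k \<le> n" "p k < p i" "p i < p j"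
      by blast
    then show ?L
      using mem(1)[of j] mem(1)[of k]
      by (intro exI[of _ "p k"] exI[of _ "p i"] exI[of _ "p j"]) auto
  qed
  then show ?thesis
    unfolding avoids_231 avoids_312 by blast
qed

lemma shallow_avoiders_312: "shallow_avoiders [3, 1, 2] n = shallow_avoiders [2, 3, 1] n"
proof -
  have "bij_betw inv {p. p permutes {1..n} \<and> shallow n p \<and> avoids n p [2, 3, 1]}
      {p. p permutes {1..n} \<and> shallow n p \<and> avoids n p [3, 1, 2]}"
  proof (rule bij_betw_byWitness[where f' = inv])
    show "inv ` {p. p permutes {1..n} \<and> shallow n p \<and> avoids n p [3, 1, 2]}
        \<subseteq> {p. p permutes {1..n} \<and> shallow n p \<and> avoids n p [2, 3, 1]}"
    proof clarify
      fix p assume p: "p permutes {1..n}" "shallow n p" "avoids n p [3, 1, 2]"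
      then show "inv p permutes {1..n} \<and> shallow n (inv p) \<and> avoids n (inv p) [2, 3, 1]"
        using avoids_inv[OF permutes_inv[OF p(1)]]
        by (simp add: permutes_inv shallow_inv permutes_inv_inv del: One_nat_def)
    qed
  qed (auto simp: permutes_inv permutes_inv_inv shallow_inv avoids_inv simp del: One_nat_def)
  then show ?thesis
    unfolding shallow_avoiders_def by (rule bij_betw_same_card[symmetric])
qed

theorem theorem4p1:
  shows "Abs_fps (\<lambda>n. of_nat (shallow_avoiders [2,3,1] n) :: rat) =
           (1 - 3 * fps_X + 2 * fps_X ^ 2 - fps_X ^ 3 - fps_X ^ 4 - fps_X ^ 5) /
           (1 - 4 * fps_X + 4 * fps_X ^ 2 - 2 * fps_X ^ 3 - fps_X ^ 4 - fps_X ^ 5)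
       \<and> Abs_fps (\<lambda>n. of_nat (shallow_avoiders [3,1,2] n) :: rat) =
           (1 - 3 * fps_X + 2 * fps_X ^ 2 - fps_X ^ 3 - fps_X ^ 4 - fps_X ^ 5) /
           (1 - 4 * fps_X + 4 * fps_X ^ 2 - 2 * fps_X ^ 3 - fps_X ^ 4 - fps_X ^ 5)"
  unfolding shallow_avoiders_312 shallow_avoiders_231 fps_perm_lists by simp

end
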